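(* Let $\mathbb{G}$ be a graded Lie group of homogeneous dimension $Q$, let $\mathcal{R}$ be a positive Rockland operator on $\mathbb{G}$ of homogeneous degree $\nu$, let $1<p<\infty$ and $1/p+1/p'=1$. Consider the inequalities $$(\mathrm{GN})\quad \|f\|_{L^{q}(\mathbb{G})}\leq C_{1}q^{1-1/p}\|\mathcal{R}^{\frac{Q}{\nu p}}f\|_{L^{p}(\mathbb{G})}^{1-p/q}\|f\|_{L^{p}(\mathbb{G})}^{p/q},$$ $$(\mathrm{T})\quad \int_{\mathbb{G}}\left(\exp(\alpha|f(x)|^{p'})-\sum_{0\leq k<p-1,\;k\in\mathbb{N}}\frac{1}{k!}(\alpha|f(x)|^{p'})^{k}\right)dx\leq C_{2}\|f\|^{p}_{L^{p}(\mathbb{G})}.$$ Then the following two assertions are equivalent: (i) there is $C_1>0$ such that $(\mathrm{GN})$ holds for all $f\in L^p_{Q/p}(\mathbb{G})$ and all $q$ with $p\le q<\infty$; (ii) there are $\alpha,C_2>0$ such that $(\mathrm{T})$ holds for all $f\in L^p_{Q/p}(\mathbb{G})$ with $\|\mathcal{R}^{\frac{Q}{\nu p}}f\|_{L^{p}(\mathbb{G})}\leq 1$. Furthermore, $$\frac{1}{\widetilde{\alpha}\,p'e}=A^{p'}=B^{p'},$$ where $$\widetilde{\alpha}=\sup\{\alpha>0:\ \exists\, C_{2}=C_{2}(\alpha) \text{ such that } (\mathrm{T}) \text{ holds } \forall f\in L_{Q/p}^{p}(\mathbb{G}) \text{ with } \|\mathcal{R}^{\frac{Q}{\nu p}}f\|_{L^{p}(\mathbb{G})}\leq1\},$$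 $$A=\inf\{C_{1}>0:\ \exists\, r=r(C_{1})\geq p \text{ such that } (\mathrm{GN}) \text{ holds } \forall f\in L_{Q/p}^{p}(\mathbb{G}),\ \forall q \text{ with } r\leq q<\infty\},$$ $$B=\limsup_{q\rightarrow \infty}\ \sup_{f\in L^p_{Q/p}(\mathbb{G})\setminus\{0\}}\frac{\|f\|_{L^{q}(\mathbb{G})}}{q^{1-1/p}\|\mathcal{R}^{\frac{Q}{\nu p}}f\|_{L^{p}(\mathbb{G})}^{1-p/q}\|f\|_{L^{p}(\mathbb{G})}^{p/q}}.$$
   Context: Here $\mathbb{N}$ includes $0$. A graded Lie group is a connected simply connected Lie group $\mathbb{G}$ whose Lie algebra decomposes as $\mathfrak{g}=\bigoplus_{\ell\geq 1}\mathfrak{g}_{\ell}$, all but finitely many $\mathfrak g_\ell$ being $\{0\}$, with $[\mathfrak{g}_{\ell},\mathfrak{g}_{\ell'}]\subset\mathfrak{g}_{\ell+\ell'}$. Using a basis $X_1,\dots,X_n$ of $\mathfrak g$ adapted to the gradation, $\mathbb{G}$ is identified with $\mathbb{R}^n$ via the exponential map; the dilations are $D_r(x)=rx=(r^{\nu_1}x_1,\dots,r^{\nu_n}x_n)$, $r>0$, with $\nu_j=\ell$ if $X_j\in\mathfrak{g}_\ell$; the homogeneous dimension is $Q=\nu_1+\dots+\nu_n$; integration is against Lebesgue measure $dx$, which is a (bi-invariant) Haar measure. A positive Rockland operator $\mathcal{R}$ of homogeneous degree $\nu>0$ is a left-invariant hypoelliptic differential operator on $\mathbb{G}$ with $\mathcal{R}(f\circ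 D_r)=r^{\nu}(\mathcal{R}f)\circ D_r$ for $r>0$, which is positive: $\int_{\mathbb{G}}(\mathcal{R}f)\overline{f}\,dx\ge 0$ for all Schwartz $f$. Its powers $\mathcal{R}^{s}$, $s>0$, are the fractional powers given by functional calculus (on $L^p$: fractional powers of the closed $L^p$-realisation of $\mathcal{R}$). For $a>0$ and $1<p<\infty$, $L^{p}_{a}(\mathbb{G})$ is the Sobolev space of $u\in L^p(\mathbb{G})$ with $\mathcal{R}^{a/\nu}u\in L^p(\mathbb{G})$, with norm $\|u\|_{L^{p}_{a}(\mathbb{G})}=\left(\int_{\mathbb{G}}(|\mathcal{R}^{a/\nu}u|^{p}+|u|^{p})dx\right)^{1/p}$. *)

theory Defs
  imports "HOL-Analysis.Analysis"
begin

section \<open>Smooth functions, test functions, Schwartz functions\<close>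

definition dderiv ::
  "'a::real_normed_vector \<Rightarrow> ('a \<Rightarrow> 'b::real_normed_vector) \<Rightarrow> 'a \<Rightarrow> 'b" where
  "dderiv v f x = vector_derivative (\<lambda>t. f (x + t *\<^sub>R v)) (at 0)"

text \<open>On an open set of a finite-dimensional space this is \<open>C\<^sup>\<infinity>\<close>: all iterated
  directional derivatives are required to be (Frechet) differentiable, hence continuous.\<close>
definition smooth_on ::
  "'a::real_normed_vector set \<Rightarrow> ('a \<Rightarrow> 'b::real_normed_vector) \<Rightarrow> bool" where
  "smooth_on S f \<longleftrightarrow> (\<forall>vs. foldr dderiv vs f differentiable_on S)"

type_synonym 'n cfun = "real^'n \<Rightarrow> complex"

definition pderivs :: "'n list \<Rightarrow> 'n::finite cfun \<Rightarrow> 'n cfun" where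
  "pderivs js f = foldr (\<lambda>j. dderiv (axis j 1)) js f"

definition test_functions :: "(real^'n::finite) set \<Rightarrow> 'n cfun set" where
  "test_functions U = {\<phi>. smooth_on UNIV \<phi> \<and>
     compact (closure {x. \<phi> x \<noteq> 0}) \<and> closure {x. \<phi> x \<noteq> 0} \<subseteq> U}"

definition schwartz :: "'n::finite cfun set" where
  "schwartz = {f. smooth_on UNIV f \<and>
     (\<forall>(k::nat) js. bounded (range (\<lambda>x. (1 + norm x) ^ k *\<^sub>R pderivs js f x)))}"

section \<open>Graded Lie groups in exponential coordinates\<close>

definition left_field ::
  "(real^'n \<Rightarrow> real^'n \<Rightarrow> real^'n) \<Rightarrow> 'n::finite \<Rightarrow> 'n cfun \<Rightarrow> 'n cfun" where
  "left_field mul j f x = vector_derivative (\<lambda>t. f (mul x (t *\<^sub>R axis j 1))) (at 0)"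

text \<open>
  A graded Lie group, identified with \<open>\<real>\<^sup>n\<close> by the exponential map and a basis
  \<open>X\<^sub>j\<close> (here \<open>left_field mul j\<close>) of its Lie algebra adapted to the gradation:
  \<open>\<gg>\<^sub>\<ell>\<close> is spanned by the \<open>X\<^sub>j\<close> with \<open>w j = \<ell>\<close>. Axiom \<open>exp_coords\<close>
  says that \<open>t \<mapsto> t x\<close> is a one-parameter subgroup, i.e. that the exponential map is the
  identity of \<open>\<real>\<^sup>n\<close>; it also makes \<open>0\<close> the neutral element and \<open>- x\<close> the
  inverse of \<open>x\<close>. Axiom \<open>graded\<close> says that
  \<open>[X\<^sub>i, X\<^sub>j] = \<Sum>\<^sub>k c\<^sub>k X\<^sub>k\<close> lies in \<open>\<gg>\<^bsub>w i + w j\<^esub>\<close>.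
\<close>
locale graded_lie_group =
  fixes mul :: "real^'n::finite \<Rightarrow> real^'n \<Rightarrow> real^'n"
    and w :: "'n \<Rightarrow> nat"
  assumes assoc: "mul (mul x y) z = mul x (mul y z)"
    and exp_coords: "mul (s *\<^sub>R x) (t *\<^sub>R x) = (s + t) *\<^sub>R x"
    and smooth_mul: "smooth_on UNIV (\<lambda>(x, y). mul x y)"
    and weight_pos: "w j \<ge> 1"
    and graded: "\<exists>c :: 'n \<Rightarrow> real. (\<forall>k. c k \<noteq> 0 \<longrightarrow> w k = w i + w j) \<and>
      (\<forall>f x. smooth_on UNIV f \<longrightarrow>
        left_field mul i (left_field mul j f) x - left_field mul j (left_field mul i f) x
          = (\<Sum>k\<in>UNIV. c k *\<^sub>R left_field mul k f x))"
begin

lemma neutral: "mul 0 x = x" "mul x 0 = x"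
  using exp_coords[of 0 x 1] exp_coords[of 1 x 0] by simp_all

lemma inverse: "mul x (- x) = 0" "mul (- x) x = 0"
  using exp_coords[of 1 x "-1"] exp_coords[of "-1" x 1] by simp_all

end

definition dilation :: "('n \<Rightarrow> nat) \<Rightarrow> real \<Rightarrow> real^'n::finite \<Rightarrow> real^'n" where
  "dilation w r x = (\<chi> j. r ^ w j * x $ j)"

definition hom_dim :: "('n::finite \<Rightarrow> nat) \<Rightarrow> nat" where
  "hom_dim w = (\<Sum>j\<in>UNIV. w j)"

section \<open>Differential operators and hypoellipticity\<close>

text \<open>A family \<open>a\<close> represents \<open>\<Sum> a\<^bsub>js\<^esub> \<partial>\<^bsub>js\<^esub>\<close>, where
  \<open>\<partial>\<^bsub>js\<^esub>\<close> is the iterated partial derivative along the word \<open>js\<close>. Words rather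
  than multi-indices are used, so the coefficients are not unique; every notion below depends
  only on the operator.\<close>
type_synonym 'n diffop = "'n list \<Rightarrow> 'n cfun"

definition is_diffop :: "'n::finite diffop \<Rightarrow> bool" where
  "is_diffop a \<longleftrightarrow> finite {js. a js \<noteq> (\<lambda>x. 0)} \<and> (\<forall>js. smooth_on UNIV (a js))"

definition dop :: "'n::finite diffop \<Rightarrow> 'n cfun \<Rightarrow> 'n cfun" where
  "dop a f x = (\<Sum>js | a js \<noteq> (\<lambda>x. 0). a js x * pderivs js f x)"

text \<open>The formal transpose: \<open>\<integral> (dop a f) \<phi> = \<integral> f (dop_transpose a \<phi>)\<close>.\<close>
definition dop_transpose :: "'n::finite diffop \<Rightarrow> 'n cfun \<Rightarrow> 'n cfun" where
  "dop_transpose a \<phi> x =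
     (\<Sum>js | a js \<noteq> (\<lambda>x. 0). (-1) ^ length js * pderivs (rev js) (\<lambda>y. a js y * \<phi> y) x)"

text \<open>Distributions on \<open>U\<close> are complex-valued functionals of which only the values on
  \<open>test_functions U\<close> matter.\<close>
definition distribution_on ::
  "(real^'n::finite) set \<Rightarrow> ('n cfun \<Rightarrow> complex) \<Rightarrow> bool" where
  "distribution_on U u \<longleftrightarrow>
     (\<forall>\<phi>\<in>test_functions U. \<forall>\<psi>\<in>test_functions U. u (\<lambda>x. \<phi> x + \<psi> x) = u \<phi> + u \<psi>) \<and>
     (\<forall>\<phi>\<in>test_functions U. \<forall>c. u (\<lambda>x. c * \<phi> x) = c * u \<phi>) \<and>
     (\<forall>K. compact K \<and> K \<subseteq> U \<longrightarrow>
        (\<exists>C (N::nat). \<forall>\<phi>\<in>test_functions U. closure {x. \<phi> x \<noteq> 0} \<subseteq> K \<longrightarrow>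
           norm (u \<phi>) \<le> C * (\<Sum>js | length js \<le> N. SUP x. norm (pderivs js \<phi> x))))"

definition smooth_distribution ::
  "(real^'n::finite) set \<Rightarrow> ('n cfun \<Rightarrow> complex) \<Rightarrow> bool" where
  "smooth_distribution U u \<longleftrightarrow>
     (\<exists>g. smooth_on U g \<and> (\<forall>\<phi>\<in>test_functions U. u \<phi> = (\<integral>x. g x * \<phi> x \<partial>lebesgue)))"

definition hypoelliptic :: "'n::finite diffop \<Rightarrow> bool" where
  "hypoelliptic a \<longleftrightarrow>
     (\<forall>U u. open U \<and> distribution_on U u \<and> smooth_distribution U (\<lambda>\<phi>. u (dop_transpose a \<phi>))
        \<longrightarrow> smooth_distribution U u)"

definition positive_rockland ::
  "(real^'n \<Rightarrow> real^'n \<Rightarrow> real^'n) \<Rightarrow> ('n::finite \<Rightarrow> nat) \<Rightarrow> real \<Rightarrow> 'n diffop \<Rightarrow> bool" where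
  "positive_rockland mul w \<nu> R \<longleftrightarrow>
     \<nu> > 0 \<and> is_diffop R \<and>
     (\<forall>f y x. smooth_on UNIV f \<longrightarrow> dop R (\<lambda>z. f (mul y z)) x = dop R f (mul y x)) \<and>
     (\<forall>r f x. r > 0 \<and> smooth_on UNIV f \<longrightarrow>
        dop R (\<lambda>z. f (dilation w r z)) x = (r powr \<nu>) *\<^sub>R dop R f (dilation w r x)) \<and>
     hypoelliptic R \<and>
     (\<forall>f\<in>schwartz. let I = (\<integral>x. dop R f x * cnj (f x) \<partial>lebesgue) in Im I = 0 \<and> Re I \<ge> 0)"

section \<open>Lebesgue spaces and fractional powers\<close>

text \<open>Only meant for exponents \<open>a > 0\<close>.\<close>
definition epowr :: "ennreal \<Rightarrow> real \<Rightarrow> ennreal" where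
  "epowr x a = (if x = \<infinity> then \<infinity> else ennreal (enn2real x powr a))"

definition eLp_norm :: "real \<Rightarrow> 'n::finite cfun \<Rightarrow> ennreal" where
  "eLp_norm p f = epowr (\<integral>\<^sup>+ x. ennreal (norm (f x) powr p) \<partial>lebesgue) (1 / p)"

definition Lp_norm :: "real \<Rightarrow> 'n::finite cfun \<Rightarrow> real" where
  "Lp_norm p f = enn2real (eLp_norm p f)"

definition Lp :: "real \<Rightarrow> 'n::finite cfun set" where
  "Lp p = {f \<in> borel_measurable lebesgue. eLp_norm p f < \<infinity>}"

text \<open>Unbounded operators on \<open>L\<^sup>p\<close> are given by their graphs. Elements of
  \<open>L\<^sup>p\<close> are represented by functions, so \<open>(u, v)\<close> in the graph means that \<open>v\<close> is
  a representative of the image of \<open>u\<close>, which is determined almost everywhere.\<close>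
type_synonym 'n graph = "('n cfun \<times> 'n cfun) set"

definition Lp_closure :: "real \<Rightarrow> 'n::finite graph \<Rightarrow> 'n graph" where
  "Lp_closure p G = {(u, v). u \<in> Lp p \<and> v \<in> Lp p \<and>
     (\<exists>f g. (\<forall>k::nat. (f k, g k) \<in> G) \<and>
        (\<lambda>k. eLp_norm p (\<lambda>x. f k x - u x)) \<longlonglongrightarrow> 0 \<and>
        (\<lambda>k. eLp_norm p (\<lambda>x. g k x - v x)) \<longlonglongrightarrow> 0)}"

definition Lp_realisation :: "real \<Rightarrow> 'n::finite diffop \<Rightarrow> 'n graph" where
  "Lp_realisation p a = Lp_closure p {(\<phi>, dop a \<phi>) |\<phi>. \<phi> \<in> test_functions UNIV}"

text \<open>The graph of \<open>A (t + A)\<^sup>-\<^sup>1\<close>: it sends \<open>t u + A u\<close> to \<open>A u\<close>.\<close>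
definition resolvent_part :: "'n::finite graph \<Rightarrow> real \<Rightarrow> 'n graph" where
  "resolvent_part A t = {(\<lambda>x. t *\<^sub>R u x + v x, v) |u v. (u, v) \<in> A}"

text \<open>
  The Balakrishnan operator of order \<open>s > 0\<close>, with domain that of \<open>A\<^sup>m\<close>, where
  \<open>m\<close> is the least integer above \<open>s\<close>:
  \<open>u \<mapsto> \<Gamma>(m) / (\<Gamma>(s) \<Gamma>(m - s)) \<integral>\<^sub>0\<^sup>\<infinity> t\<^bsup>s - 1\<^esup> (A (t + A)\<^sup>-\<^sup>1)\<^sup>m u dt\<close>.
  The \<open>L\<^sup>p\<close>-valued integral is taken in the weak sense, against the dual space
  \<open>L\<^sup>q\<close>, \<open>1/p + 1/q = 1\<close>; for non-negative \<open>A\<close> and \<open>u\<close> in the domain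
  of \<open>A\<^sup>m\<close> it is absolutely convergent in norm.
\<close>
definition balakrishnan :: "real \<Rightarrow> 'n::finite graph \<Rightarrow> real \<Rightarrow> 'n graph" where
  "balakrishnan p A s = {(u, v). v \<in> Lp p \<and> (let m = Suc (nat \<lfloor>s\<rfloor>) in
     u \<in> Domain (A ^^ m) \<and>
     (\<exists>h. (\<forall>t>0. (u, h t) \<in> resolvent_part A t ^^ m) \<and>
        (\<forall>\<psi>\<in>Lp (p / (p - 1)).
           set_integrable lborel {0<..}
             (\<lambda>t. (t powr (s - 1)) *\<^sub>R (\<integral>x. h t x * \<psi> x \<partial>lebesgue)) \<and>
           (\<integral>x. v x * \<psi> x \<partial>lebesgue) = (1 / Beta s (real m - s)) *\<^sub>R
             (LINT t:{0<..}|lborel. (t powr (s - 1)) *\<^sub>R (\<integral>x. h t x * \<psi> x \<partial>lebesgue)))))}"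

text \<open>The fractional power \<open>A\<^sup>s\<close>, \<open>s > 0\<close>, of a densely defined closed non-negative
  operator is the closure of the Balakrishnan operator.\<close>
definition frac_power :: "real \<Rightarrow> 'n::finite graph \<Rightarrow> real \<Rightarrow> 'n graph" where
  "frac_power p A s = Lp_closure p (balakrishnan p A s)"

definition rockland_power :: "real \<Rightarrow> 'n::finite diffop \<Rightarrow> real \<Rightarrow> 'n graph" where
  "rockland_power p R s = frac_power p (Lp_realisation p R) s"

definition sobolev :: "real \<Rightarrow> 'n::finite diffop \<Rightarrow> real \<Rightarrow> real \<Rightarrow> 'n cfun set" where
  "sobolev p R \<nu> a = {u \<in> Lp p. \<exists>v\<in>Lp p. (u, v) \<in> rockland_power p R (a / \<nu>)}"

section \<open>The two inequalities\<close>

text \<open>In both inequalities and in \<open>GN_ratio\<close>, \<open>g\<close> stands for (a representative of)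
  the fractional power of the Rockland operator applied to \<open>f\<close>.\<close>

definition GN :: "real \<Rightarrow> real \<Rightarrow> real \<Rightarrow> 'n::finite cfun \<Rightarrow> 'n cfun \<Rightarrow> bool" where
  "GN p C q f g \<longleftrightarrow> eLp_norm q f \<le>
     ennreal (C * q powr (1 - 1 / p) * Lp_norm p g powr (1 - p / q) * Lp_norm p f powr (p / q))"

definition Trudinger :: "real \<Rightarrow> real \<Rightarrow> real \<Rightarrow> real \<Rightarrow> 'n::finite cfun \<Rightarrow> bool" where
  "Trudinger p p' \<alpha> C f \<longleftrightarrow>
     (\<integral>\<^sup>+ x. ennreal (exp (\<alpha> * norm (f x) powr p')
         - (\<Sum>k | real k < p - 1. (1 / fact k) * (\<alpha> * norm (f x) powr p') ^ k)) \<partial>lebesgue)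
       \<le> ennreal (C * Lp_norm p f powr p)"

text \<open>In \<open>ennreal\<close>, \<open>c / 0 = \<infinity>\<close> for \<open>c \<noteq> 0\<close>.\<close>
definition GN_ratio :: "real \<Rightarrow> real \<Rightarrow> 'n::finite cfun \<Rightarrow> 'n cfun \<Rightarrow> ennreal" where
  "GN_ratio p q f g = eLp_norm q f /
     ennreal (q powr (1 - 1 / p) * Lp_norm p g powr (1 - p / q) * Lp_norm p f powr (p / q))"

text \<open>The three constants are taken in \<open>[0, \<infinity>]\<close>; \<open>W\<close> is the function space and
  \<open>P\<close> the graph of the fractional power.\<close>

definition alpha_tilde ::
  "real \<Rightarrow> real \<Rightarrow> 'n::finite cfun set \<Rightarrow> 'n graph \<Rightarrow> ennreal" where
  "alpha_tilde p p' W P = Sup {ennreal \<alpha> |\<alpha>. \<alpha> > 0 \<and>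
     (\<exists>C>0. \<forall>f\<in>W. \<forall>g. (f, g) \<in> P \<and> Lp_norm p g \<le> 1 \<longrightarrow> Trudinger p p' \<alpha> C f)}"

definition GN_inf :: "real \<Rightarrow> 'n::finite cfun set \<Rightarrow> 'n graph \<Rightarrow> ennreal" where
  "GN_inf p W P = Inf {ennreal C |C. C > 0 \<and>
     (\<exists>r\<ge>p. \<forall>f\<in>W. \<forall>g. (f, g) \<in> P \<longrightarrow> (\<forall>q\<ge>r. GN p C q f g))}"

definition GN_limsup :: "real \<Rightarrow> 'n::finite cfun set \<Rightarrow> 'n graph \<Rightarrow> ennreal" where
  "GN_limsup p W P = Limsup at_top (\<lambda>q::real.
     Sup {GN_ratio p q f g |f g. f \<in> W \<and> (f, g) \<in> P \<and> \<not> (AE x in lebesgue. f x = 0)})"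

end

theory Submission
  imports Defs "HOL-Real_Asymp.Real_Asymp"
begin

text \<open>
  The graph of the fractional power is invariant under \<open>(f, g) \<mapsto> (c f, c g)\<close>, \<open>c > 0\<close>,
  which reduces (GN) to pairs with \<open>\<parallel>g\<parallel>\<^sub>p \<le> 1\<close>.
  Integrating the series of the exponential tail termwise, the \<open>k\<close>-th term involves
  \<open>\<parallel>f\<parallel>\<^sub>q\<close> with \<open>q = p' k\<close>, and (GN) bounds it by
  \<open>(\<alpha> p' C\<^bsup>p'\<^esup>)\<^bsup>k\<^esup> k\<^bsup>k\<^esup> / k! \<le> (\<alpha> p' e C\<^bsup>p'\<^esup>)\<^bsup>k\<^esup>\<close>
  times \<open>\<parallel>f\<parallel>\<^sub>p\<^bsup>p\<^esup>\<close>, so that (T) holds as soon as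
  \<open>\<alpha> p' e C\<^bsup>p'\<^esup> < 1\<close>. Conversely \<open>y\<^bsup>s\<^esup>\<close> is at most the tail times
  \<open>(s / e)\<^bsup>s\<^esup>\<close>, up to a polynomial factor in \<open>s\<close>; with \<open>y = \<alpha> |f|\<^bsup>p'\<^esup>\<close>
  and \<open>s = q / p'\<close>, (T) yields (GN) for all large \<open>q\<close> whenever
  \<open>\<alpha> p' e C\<^bsup>p'\<^esup> > 1\<close>. The two thresholds match, which gives the identity between the
  constants; intermediate exponents follow from
  \<open>|f|\<^bsup>q\<^esup> \<le> |f|\<^bsup>p\<^esup> + |f|\<^bsup>r\<^esup>\<close>, \<open>p \<le> q \<le> r\<close>.
\<close>

section \<open>Positive homogeneity of the fractional powers\<close>

text \<open>The factors are positive reals, since they serve to normalise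
  \<open>Lp_norm p g\<close>.\<close>

definition pos_homogeneous :: "'n::finite graph \<Rightarrow> bool" where
  "pos_homogeneous G \<longleftrightarrow>
     (\<forall>c>0. \<forall>u v. (u, v) \<in> G \<longrightarrow> ((\<lambda>x. c *\<^sub>R u x), (\<lambda>x. c *\<^sub>R v x)) \<in> G)"

lemma pos_homogeneousD:
  assumes "pos_homogeneous G" "c > 0" "(u, v) \<in> G"
  shows "((\<lambda>x. c *\<^sub>R u x), (\<lambda>x. c *\<^sub>R v x)) \<in> G"
  using assms unfolding pos_homogeneous_def by blast

lemma pos_homogeneous_relpow:
  assumes "pos_homogeneous G"
  shows "pos_homogeneous (G ^^ m)"
proof (induction m)
  case 0
  then show ?case by (simp add: pos_homogeneous_def)
next
  case (Suc m)
  then show ?case using assms unfolding pos_homogeneous_def by (auto simp: relcomp_unfold) blast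
qed

section \<open>Scalars commute with derivatives and differential operators\<close>

lemma dderiv_scaleR:
  assumes "f differentiable_on UNIV"
  shows "dderiv v (\<lambda>x. c *\<^sub>R f x) = (\<lambda>x. c *\<^sub>R dderiv v f x)"
proof
  fix x
  have "f differentiable at (x + 0 *\<^sub>R v)"
    using assms by (simp add: differentiable_on_def)
  moreover have "(\<lambda>t::real. x + t *\<^sub>R v) differentiable at 0"
    by (intro differentiable_add differentiable_const differentiable_scaleR) auto
  \<comment> \<open>\<open>vector_derivative\<close> is unspecified where no derivative exists, so
    an actual derivative along the line is produced first.\<close>
  ultimately have "(\<lambda>t. f (x + t *\<^sub>R v)) differentiable at 0"
    using differentiable_chain_at[of "\<lambda>t::real. x + t *\<^sub>R v" 0 f] by (simp add: o_def)
  then have "((\<lambda>t. f (x + t *\<^sub>R v)) has_vector_derivative dderiv v f x) (at 0)"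
    by (simp add: dderiv_def vector_derivative_works)
  then have "((\<lambda>t. c *\<^sub>R f (x + t *\<^sub>R v)) has_vector_derivative c *\<^sub>R dderiv v f x) (at 0)"
    by (rule bounded_linear.has_vector_derivative[OF bounded_linear_scaleR_right])
  then show "dderiv v (\<lambda>x. c *\<^sub>R f x) x = c *\<^sub>R dderiv v f x"
    by (simp add: dderiv_def vector_derivative_at)
qed

lemma foldr_dderiv_scaleR:
  assumes "smooth_on UNIV f"
  shows "foldr dderiv vs (\<lambda>x. c *\<^sub>R f x) = (\<lambda>x. c *\<^sub>R foldr dderiv vs f x)"
  using assms by (induction vs) (simp_all add: dderiv_scaleR smooth_on_def)

lemma smooth_on_scaleR:
  assumes "smooth_on UNIV f"
  shows "smooth_on UNIV (\<lambda>x. c *\<^sub>R f x)"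
  unfolding smooth_on_def foldr_dderiv_scaleR[OF assms]
  using assms by (auto simp: smooth_on_def differentiable_on_def intro!: differentiable_scaleR)

lemma pderivs_scaleR:
  assumes "smooth_on UNIV f"
  shows "pderivs js (\<lambda>x. c *\<^sub>R f x) = (\<lambda>x. c *\<^sub>R pderivs js f x)"
proof -
  have "pderivs js h = foldr dderiv (map (\<lambda>j. axis j 1) js) h" for h :: "'a cfun"
    unfolding pderivs_def by (induction js) auto
  then show ?thesis using foldr_dderiv_scaleR[OF assms] by simp
qed

lemma dop_scaleR:
  assumes "smooth_on UNIV f"
  shows "dop a (\<lambda>x. c *\<^sub>R f x) = (\<lambda>x. c *\<^sub>R dop a f x)"
  unfolding dop_def pderivs_scaleR[OF assms] by (simp add: scaleR_right.sum)

lemma test_functions_scaleR: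
  assumes "\<phi> \<in> test_functions U" "c > 0"
  shows "(\<lambda>x. c *\<^sub>R \<phi> x) \<in> test_functions U"
  using assms by (auto simp: test_functions_def smooth_on_scaleR)

section \<open>Powers in \<open>[0, \<infinity>]\<close> and norms under scaling\<close>

lemma epowr_ennreal: "0 \<le> x \<Longrightarrow> epowr (ennreal x) a = ennreal (x powr a)"
  by (simp add: epowr_def)

lemma epowr_cmult:
  assumes "c > 0"
  shows "epowr (ennreal c * x) a = ennreal (c powr a) * epowr x a"
proof (cases x)
  case (real r)
  then show ?thesis
    using assms by (simp add: ennreal_mult[symmetric] epowr_ennreal powr_mult)
next
  case top
  then show ?thesis using assms by (simp add: epowr_def ennreal_mult_top)
qed

text \<open>The \<open>q\<close>-th power of the norm, possibly infinite: norm estimates raised to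
  the power \<open>q\<close> become linear in it.\<close>

definition power_integral :: "real \<Rightarrow> 'n::finite cfun \<Rightarrow> ennreal" where
  "power_integral q f = (\<integral>\<^sup>+ x. ennreal (norm (f x) powr q) \<partial>lebesgue)"

lemma eLp_norm_power_integral: "eLp_norm q f = epowr (power_integral q f) (1 / q)"
  by (simp add: eLp_norm_def power_integral_def)

text \<open>Unlike \<open>nn_integral_cmult\<close>, this needs no measurability, which is not known for the
  members of an arbitrary graph.\<close>
lemma nn_integral_cmult_pos:
  assumes "c > 0"
  shows "(\<integral>\<^sup>+ x. ennreal c * f x \<partial>M) = ennreal c * integral\<^sup>N M f"
proof -
  \<comment> \<open>Scaling the simple functions below \<open>h\<close> gives one inequality for
    every factor; the reverse one is the case of the factor \<open>1 / c\<close> applied to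
    \<open>c * f\<close>.\<close>
  have le: "ennreal d * integral\<^sup>N M h \<le> (\<integral>\<^sup>+ x. ennreal d * h x \<partial>M)" for d h
  proof -
    have "ennreal d * integral\<^sup>N M h
        = (SUP g \<in> {g. simple_function M g \<and> g \<le> h}. ennreal d * integral\<^sup>S M g)"
      unfolding nn_integral_def
      by (rule SUP_mult_left_ennreal)
    also have "\<dots> \<le> (\<integral>\<^sup>+ x. ennreal d * h x \<partial>M)"
    proof (rule SUP_least)
      fix g assume "g \<in> {g. simple_function M g \<and> g \<le> h}"
      then have g: "simple_function M g" and "g \<le> h" by auto
      have "ennreal d * integral\<^sup>S M g = (\<integral>\<^sup>Sx. ennreal d * g x \<partial>M)"
        using g by simp
      also have "\<dots> = (\<integral>\<^sup>+x. ennreal d * g x \<partial>M)"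
        using g by (intro nn_integral_eq_simple_integral[symmetric]) auto
      also have "\<dots> \<le> (\<integral>\<^sup>+ x. ennreal d * h x \<partial>M)"
        using \<open>g \<le> h\<close> by (intro nn_integral_mono mult_left_mono) (auto simp: le_fun_def)
      finally show "ennreal d * integral\<^sup>S M g \<le> (\<integral>\<^sup>+ x. ennreal d * h x \<partial>M)" .
    qed
    finally show ?thesis .
  qed
  have inv: "ennreal c * (ennreal (1 / c) * y) = y" for y
    using assms by (simp add: mult.assoc[symmetric] ennreal_mult[symmetric])
  have inv': "ennreal (1 / c) * (ennreal c * y) = y" for y
    using inv[of y] by (simp add: ac_simps)
  have "(\<integral>\<^sup>+ x. ennreal c * f x \<partial>M)
      = ennreal c * (ennreal (1 / c) * (\<integral>\<^sup>+ x. ennreal c * f x \<partial>M))"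
    by (simp add: inv)
  also have "\<dots> \<le> ennreal c * integral\<^sup>N M f"
    using le[of "1 / c" "\<lambda>x. ennreal c * f x"] by (intro mult_left_mono) (simp_all add: inv')
  finally show ?thesis using le[of c f] by (rule antisym)
qed

lemma power_integral_scaleR:
  assumes "c > 0"
  shows "power_integral q (\<lambda>x. c *\<^sub>R f x) = ennreal (c powr q) * power_integral q f"
  using assms unfolding power_integral_def
  by (subst nn_integral_cmult_pos[symmetric]) (auto simp: powr_mult ennreal_mult)

lemma eLp_norm_scaleR:
  assumes "c > 0" "p > 0"
  shows "eLp_norm p (\<lambda>x. c *\<^sub>R f x) = ennreal c * eLp_norm p f"
  using assms by (simp add: eLp_norm_power_integral power_integral_scaleR epowr_cmult powr_powr)

lemma Lp_norm_scaleR: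
  assumes "c > 0" "p > 0"
  shows "Lp_norm p (\<lambda>x. c *\<^sub>R f x) = c * Lp_norm p f"
  using assms by (simp add: Lp_norm_def eLp_norm_scaleR enn2real_mult)

lemma Lp_scaleR:
  assumes "c > 0" "p > 0" "f \<in> Lp p"
  shows "(\<lambda>x. c *\<^sub>R f x) \<in> Lp p"
  using assms by (auto simp: Lp_def eLp_norm_scaleR ennreal_mult_less_top)

section \<open>Homogeneity passes through closures, resolvents and the Balakrishnan integral\<close>

lemma pos_homogeneous_Lp_closure:
  assumes "pos_homogeneous G" "p > 0"
  shows "pos_homogeneous (Lp_closure p G)"
  unfolding pos_homogeneous_def
proof (intro allI impI)
  fix c :: real and u v
  assume c: "c > 0" and "(u, v) \<in> Lp_closure p G"
  then obtain f g where uv: "u \<in> Lp p" "v \<in> Lp p" and fg: "\<And>k::nat. (f k, g k) \<in> G"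
    and lim: "(\<lambda>k. eLp_norm p (\<lambda>x. f k x - u x)) \<longlonglongrightarrow> 0"
      "(\<lambda>k. eLp_norm p (\<lambda>x. g k x - v x)) \<longlonglongrightarrow> 0"
    unfolding Lp_closure_def by blast
  have scale: "(\<lambda>k. eLp_norm p (\<lambda>x. c *\<^sub>R F k x - c *\<^sub>R w x)) \<longlonglongrightarrow> 0"
    if "(\<lambda>k. eLp_norm p (\<lambda>x. F k x - w x)) \<longlonglongrightarrow> 0" for F :: "nat \<Rightarrow> 'a cfun" and w
  proof -
    have "eLp_norm p (\<lambda>x. c *\<^sub>R F k x - c *\<^sub>R w x) = ennreal c * eLp_norm p (\<lambda>x. F k x - w x)" for k
      using eLp_norm_scaleR[OF c \<open>p > 0\<close>, of "\<lambda>x. F k x - w x"] by (simp add: scaleR_diff_right)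
    then show ?thesis using ennreal_tendsto_cmult[OF _ that, of "ennreal c"] by simp
  qed
  show "((\<lambda>x. c *\<^sub>R u x), (\<lambda>x. c *\<^sub>R v x)) \<in> Lp_closure p G"
    unfolding Lp_closure_def mem_Collect_eq prod.case
    using Lp_scaleR[OF c \<open>p > 0\<close>] uv scale[OF lim(1)] scale[OF lim(2)]
      pos_homogeneousD[OF assms(1) c fg]
    by (intro conjI exI[of _ "\<lambda>k x. c *\<^sub>R f k x"] exI[of _ "\<lambda>k x. c *\<^sub>R g k x"] allI)
qed

lemma pos_homogeneous_Lp_realisation:
  assumes "p > 0"
  shows "pos_homogeneous (Lp_realisation p a)"
proof -
  have "((\<lambda>x. c *\<^sub>R \<phi> x), (\<lambda>x. c *\<^sub>R dop a \<phi> x))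
      \<in> {(\<phi>, dop a \<phi>) |\<phi>. \<phi> \<in> test_functions UNIV}"
    if "c > 0" "\<phi> \<in> test_functions UNIV" for c \<phi>
  proof -
    have "smooth_on UNIV \<phi>" using that by (simp add: test_functions_def)
    then show ?thesis
      using test_functions_scaleR[OF that(2,1)] dop_scaleR[of \<phi> a c]
      by (auto intro!: exI[of _ "\<lambda>x. c *\<^sub>R \<phi> x"])
  qed
  then show ?thesis
    unfolding Lp_realisation_def
    by (intro pos_homogeneous_Lp_closure assms) (auto simp: pos_homogeneous_def)
qed

lemma pos_homogeneous_resolvent_part:
  assumes "pos_homogeneous A"
  shows "pos_homogeneous (resolvent_part A t)"
  unfolding pos_homogeneous_def
proof (intro allI impI)
  fix c :: real and f g
  assume c: "c > 0" and "(f, g) \<in> resolvent_part A t"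
  then obtain u where u: "f = (\<lambda>x. t *\<^sub>R u x + g x)" "(u, g) \<in> A"
    unfolding resolvent_part_def by blast
  have "(\<lambda>x. c *\<^sub>R f x) = (\<lambda>x. t *\<^sub>R (c *\<^sub>R u x) + c *\<^sub>R g x)"
    using u(1) by (simp add: scaleR_add_right mult.commute)
  then show "((\<lambda>x. c *\<^sub>R f x), (\<lambda>x. c *\<^sub>R g x)) \<in> resolvent_part A t"
    unfolding resolvent_part_def using pos_homogeneousD[OF assms c u(2)]
    by (auto intro!: exI[of _ "\<lambda>x. c *\<^sub>R u x"])
qed

lemma pos_homogeneous_balakrishnan:
  assumes A: "pos_homogeneous A" and "p > 0"
  shows "pos_homogeneous (balakrishnan p A s)"
  unfolding pos_homogeneous_def
proof (intro allI impI)
  fix c :: real and u v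
  assume c: "c > 0" and uv: "(u, v) \<in> balakrishnan p A s"
  define m where "m = Suc (nat \<lfloor>s\<rfloor>)"
  from uv obtain h where v: "v \<in> Lp p" and u: "u \<in> Domain (A ^^ m)"
    and h: "\<And>t. t > 0 \<Longrightarrow> (u, h t) \<in> resolvent_part A t ^^ m"
    and int: "\<And>\<psi>. \<psi> \<in> Lp (p / (p - 1)) \<Longrightarrow> set_integrable lborel {0<..}
             (\<lambda>t. (t powr (s - 1)) *\<^sub>R (\<integral>x. h t x * \<psi> x \<partial>lebesgue))"
    and eq: "\<And>\<psi>. \<psi> \<in> Lp (p / (p - 1)) \<Longrightarrow>
        (\<integral>x. v x * \<psi> x \<partial>lebesgue) = (1 / Beta s (real m - s)) *\<^sub>R
             (LINT t:{0<..}|lborel. (t powr (s - 1)) *\<^sub>R (\<integral>x. h t x * \<psi> x \<partial>lebesgue))"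
    unfolding balakrishnan_def Let_def m_def[symmetric] by blast
  \<comment> \<open>True for non-integrable products as well: as \<open>c > 0\<close>, both
    integrals are then 0 by default.\<close>
  have pull: "(\<integral>x. c *\<^sub>R F x * \<psi> x \<partial>lebesgue) = c *\<^sub>R (\<integral>x. F x * \<psi> x \<partial>lebesgue)"
    for F \<psi> :: "'a cfun"
    by simp
  have "(\<lambda>x. c *\<^sub>R u x) \<in> Domain (A ^^ m)"
    using u pos_homogeneousD[OF pos_homogeneous_relpow[OF A] c] by blast
  moreover have "((\<lambda>x. c *\<^sub>R u x), (\<lambda>x. c *\<^sub>R h t x)) \<in> resolvent_part A t ^^ m" if "t > 0" for t
    using pos_homogeneousD[OF pos_homogeneous_relpow[OF pos_homogeneous_resolvent_part[OF A]] c h[OF that]] .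
  moreover have "set_integrable lborel {0<..}
             (\<lambda>t. (t powr (s - 1)) *\<^sub>R (\<integral>x. c *\<^sub>R h t x * \<psi> x \<partial>lebesgue))"
    and "(\<integral>x. c *\<^sub>R v x * \<psi> x \<partial>lebesgue) = (1 / Beta s (real m - s)) *\<^sub>R
             (LINT t:{0<..}|lborel. (t powr (s - 1)) *\<^sub>R (\<integral>x. c *\<^sub>R h t x * \<psi> x \<partial>lebesgue))"
    if "\<psi> \<in> Lp (p / (p - 1))" for \<psi>
  proof -
    have comm: "(t powr (s - 1)) *\<^sub>R (\<integral>x. c *\<^sub>R h t x * \<psi> x \<partial>lebesgue)
        = c *\<^sub>R ((t powr (s - 1)) *\<^sub>R (\<integral>x. h t x * \<psi> x \<partial>lebesgue))" for t
      unfolding pull by (simp add: mult.commute)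
    show "set_integrable lborel {0<..}
             (\<lambda>t. (t powr (s - 1)) *\<^sub>R (\<integral>x. c *\<^sub>R h t x * \<psi> x \<partial>lebesgue))"
      unfolding comm using int[OF that] by (intro set_integrable_scaleR_right) auto
    show "(\<integral>x. c *\<^sub>R v x * \<psi> x \<partial>lebesgue) = (1 / Beta s (real m - s)) *\<^sub>R
             (LINT t:{0<..}|lborel. (t powr (s - 1)) *\<^sub>R (\<integral>x. c *\<^sub>R h t x * \<psi> x \<partial>lebesgue))"
      unfolding comm unfolding set_integral_scaleR_right pull eq[OF that]
      by (rule scaleR_left_commute)
  qed
  ultimately show "((\<lambda>x. c *\<^sub>R u x), (\<lambda>x. c *\<^sub>R v x)) \<in> balakrishnan p A s"
    unfolding balakrishnan_def Let_def m_def[symmetric] mem_Collect_eq prod.case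
    using Lp_scaleR[OF c \<open>p > 0\<close> v]
    by (intro conjI exI[of _ "\<lambda>t x. c *\<^sub>R h t x"] allI ballI impI)
qed

lemma pos_homogeneous_rockland_power:
  "p > 0 \<Longrightarrow> pos_homogeneous (rockland_power p R s)"
  unfolding rockland_power_def frac_power_def
  by (intro pos_homogeneous_Lp_closure pos_homogeneous_balakrishnan pos_homogeneous_Lp_realisation)

lemma rockland_power_Lp:
  "(f, g) \<in> rockland_power p R s \<Longrightarrow> f \<in> Lp p \<and> g \<in> Lp p"
  by (simp add: rockland_power_def frac_power_def Lp_closure_def)

section \<open>Tails of the exponential series\<close>

text \<open>With \<open>a = p - 1\<close> and \<open>y = \<alpha> * norm (f x) powr p'\<close> this
  is the integrand of (T).\<close>

definition exp_tail :: "real \<Rightarrow> real \<Rightarrow> real" where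
  "exp_tail a y = exp y - (\<Sum>k | real k < a. (1 / fact k) * y ^ k)"

text \<open>\<open>real k < a\<close> means \<open>k < nat \<lceil>a\<rceil>\<close>, so the
  subtraction removes an initial segment of the exponential series.\<close>

lemma exp_tail_sums:
  "(\<lambda>i. y ^ (i + nat \<lceil>a\<rceil>) / fact (i + nat \<lceil>a\<rceil>)) sums exp_tail a y"
proof -
  have "{k. real k < a} = {..<nat \<lceil>a\<rceil>}" by (simp add: set_eq_iff zless_nat_eq_int_zless less_ceiling_iff)
  then have "exp_tail a y = exp y - (\<Sum>k<nat \<lceil>a\<rceil>. y ^ k / fact k)"
    by (simp add: exp_tail_def)
  moreover have "(\<lambda>k. y ^ k / fact k) sums exp y"
    using exp_converges[of y] by (simp add: divide_inverse mult.commute)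
  ultimately show ?thesis
    using sums_split_initial_segment[of "\<lambda>k. y ^ k / fact k" "exp y" "nat \<lceil>a\<rceil>"] by simp
qed

lemma exp_tail_nonneg:
  assumes "y \<ge> 0"
  shows "0 \<le> exp_tail a y"
  unfolding sums_unique[OF exp_tail_sums[of y a]] using assms
  by (intro suminf_nonneg sums_summable[OF exp_tail_sums]) auto

lemma exp_tail_ge:
  assumes "y \<ge> 0" "a \<le> real k"
  shows "y ^ k / fact k \<le> exp_tail a y"
proof -
  have "nat \<lceil>a\<rceil> \<le> k" using assms(2) by (simp add: nat_le_iff ceiling_le_iff)
  then obtain i where i: "k = i + nat \<lceil>a\<rceil>" by (metis add.commute le_Suc_ex)
  have "sum (\<lambda>i. y ^ (i + nat \<lceil>a\<rceil>) / fact (i + nat \<lceil>a\<rceil>)) {i} \<le> exp_tail a y"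
    unfolding sums_unique[OF exp_tail_sums[of y a]] using assms(1)
    by (intro sum_le_suminf sums_summable[OF exp_tail_sums]) auto
  then show ?thesis by (simp add: i)
qed

text \<open>The left side is the \<open>k\<close>-th term of the series for \<open>exp k\<close>.
  This is the source of the factor \<open>e\<close> in the threshold for passing from (GN) to
  (T).\<close>

lemma power_le_exp_times_fact: "real k ^ k / fact k \<le> exp 1 ^ k"
proof -
  have "real k ^ k / fact k \<le> exp_tail 0 (real k)" by (intro exp_tail_ge) auto
  also have "\<dots> = exp 1 ^ k" by (simp add: exp_tail_def exp_of_nat_mult[symmetric])
  finally show ?thesis .
qed

text \<open>The upper half of Stirling's formula up to a polynomial factor, with
  \<open>exp (k * ln k - k)\<close> standing for \<open>(k / e)^k\<close>.\<close>

lemma fact_le_power_div_exp: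
  assumes "k \<ge> 1"
  shows "(fact k :: real) \<le> exp 1 * k * exp (k * ln k - k)"
  using assms
proof (induction k rule: dec_induct)
  case base
  then show ?case by (simp add: exp_minus)
next
  case (step k)
  define x where "x = real k"
  have x: "x \<ge> 1" using step by (simp add: x_def)
  \<comment> \<open>Multiplied by \<open>x + 1\<close>, this shows that passing from
    \<open>x\<close> to \<open>x + 1\<close> multiplies \<open>(x / e)^x\<close> by at least
    \<open>x\<close>.\<close>
  have "ln (x / (x + 1)) \<le> x / (x + 1) - 1"
    using x by (intro ln_le_minus_one) auto
  then have "(x + 1) * (ln x - ln (x + 1)) \<le> (x + 1) * (x / (x + 1) - 1)"
    using x by (intro mult_left_mono) (auto simp: ln_div)
  also have "\<dots> = -1" using x by (simp add: field_simps)
  finally have *: "ln x + (x * ln x - x) \<le> (x + 1) * ln (x + 1) - (x + 1)"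
    by (simp add: algebra_simps)
  have "(fact (Suc k) :: real) = (x + 1) * fact k" by (simp add: x_def)
  also have "\<dots> \<le> (x + 1) * (exp 1 * x * exp (x * ln x - x))"
    using step x by (intro mult_left_mono) (auto simp: x_def)
  also have "\<dots> = exp 1 * (x + 1) * exp (ln x + (x * ln x - x))"
    using x unfolding exp_add by simp
  also have "\<dots> \<le> exp 1 * (x + 1) * exp ((x + 1) * ln (x + 1) - (x + 1))"
    using * x by (intro mult_left_mono) auto
  finally show ?case by (simp add: x_def add.commute)
qed

text \<open>\<open>s * ln s - s\<close> increases for \<open>s \<ge> 1\<close>, so the integer
  \<open>k\<close> may be replaced by any larger real; \<open>ln z \<le> z - 1\<close> replaces the
  derivative.\<close>

lemma fact_le_powr_div_exp:
  assumes "k \<ge> 1" "real k \<le> s"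
  shows "fact k \<le> exp 1 * s * (s / exp 1) powr s"
proof -
  define x where "x = real k"
  have x: "x \<ge> 1" "x \<le> s" using assms by (auto simp: x_def)
  have "ln (x / s) \<le> x / s - 1" using x by (intro ln_le_minus_one) auto
  then have "s * (ln x - ln s) \<le> s * (x / s - 1)"
    using x by (intro mult_left_mono) (auto simp: ln_div)
  also have "\<dots> = x - s" using x by (simp add: field_simps)
  finally have "s * ln x - x \<le> s * ln s - s" by (simp add: algebra_simps)
  moreover have "x * ln x \<le> s * ln x" using x by (intro mult_right_mono) auto
  ultimately have *: "x * ln x - x \<le> s * ln s - s" by simp
  have "fact k \<le> exp 1 * x * exp (x * ln x - x)"
    using fact_le_power_div_exp[OF assms(1)] by (simp add: x_def)
  also have "\<dots> \<le> exp 1 * s * exp (s * ln s - s)"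
    using * x by (intro mult_mono) auto
  also have "exp (s * ln s - s) = (s / exp 1) powr s"
    using x by (simp add: powr_def ln_div algebra_simps)
  finally show ?thesis .
qed

text \<open>Serves twice: to interpolate between exponents of integrability, and to bound a real
  power by the neighbouring integer powers.\<close>

lemma powr_le_sum_of_powr:
  fixes x :: real
  assumes "0 \<le> x" "a \<le> s" "s \<le> b"
  shows "x powr s \<le> x powr a + x powr b"
proof (cases "x \<le> 1")
  case True
  then have "x powr s \<le> x powr a" using assms powr_mono'[of a s x] by simp
  then show ?thesis by (simp add: add_increasing2)
next
  case False
  then have "x powr s \<le> x powr b" using assms by (intro powr_mono) auto
  then show ?thesis by (simp add: add_increasing)
qed

text \<open>With \<open>k\<close> the floor of \<open>s\<close>, \<open>y powr s\<close> is at most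
  \<open>y^k + y^(k+1)\<close>. Both powers occur in the tail because \<open>s \<ge> a + 1\<close>
  forces \<open>k \<ge> a\<close>, and \<open>k! + (k+1)! = (k + 2) * k!\<close>.\<close>

lemma powr_le_exp_tail:
  assumes "y \<ge> 0" "s \<ge> max 1 (a + 1)"
  shows "y powr s \<le> (s + 2) * (exp 1 * s * (s / exp 1) powr s) * exp_tail a y"
proof -
  define k where "k = nat \<lfloor>s\<rfloor>"
  have k: "k \<ge> 1" "real k \<le> s" "s \<le> real (Suc k)" "a \<le> real k"
    using assms(2) unfolding k_def by (auto simp: le_nat_iff le_floor_iff) linarith+
  have pw: "y powr real j \<le> fact j * exp_tail a y" if "j \<ge> k" for j
  proof -
    have "y powr real j = y ^ j" using assms(1) that k(1) by (intro powr_realpow') auto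
    moreover have "y ^ j / fact j \<le> exp_tail a y" using k(4) that assms(1) by (intro exp_tail_ge) auto
    ultimately show ?thesis by (simp add: field_simps)
  qed
  have "y powr s \<le> y powr real k + y powr real (Suc k)"
    using assms(1) k by (intro powr_le_sum_of_powr) auto
  also have "\<dots> \<le> fact k * exp_tail a y + fact (Suc k) * exp_tail a y"
    by (rule add_mono) (rule pw, simp)+
  also have "\<dots> = (real k + 2) * fact k * exp_tail a y" by (simp add: algebra_simps)
  also have "\<dots> \<le> (s + 2) * (exp 1 * s * (s / exp 1) powr s) * exp_tail a y"
    using k exp_tail_nonneg[OF assms(1)] fact_le_powr_div_exp[OF k(1,2)] by (intro mult_mono) auto
  finally show ?thesis .
qed

section \<open>Homogeneous graphs in \<open>L\<^sup>p\<close>\<close>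

lemma power_integral_eq_Lp_norm:
  assumes "f \<in> Lp p" "p > 0"
  shows "power_integral p f = ennreal (Lp_norm p f powr p)"
proof -
  have "power_integral p f \<noteq> \<infinity>"
    using assms by (auto simp: Lp_def eLp_norm_power_integral epowr_def)
  then obtain i where "i \<ge> 0" "power_integral p f = ennreal i"
    by (cases "power_integral p f") auto
  then show ?thesis
    using assms by (simp add: Lp_norm_def eLp_norm_power_integral epowr_ennreal powr_powr)
qed

lemma eLp_norm_le_iff:
  assumes "q > 0" "b \<ge> 0"
  shows "eLp_norm q f \<le> ennreal b \<longleftrightarrow> power_integral q f \<le> ennreal (b powr q)"
proof (cases "power_integral q f")
  case (real i)
  have "i powr (1 / q) \<le> b \<longleftrightarrow> i \<le> b powr q"
    using powr_mono2[of q "i powr (1 / q)" b] powr_mono2[of "1 / q" i "b powr q"] assms real(1)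
    by (auto simp: powr_powr)
  then show ?thesis using real assms by (simp add: eLp_norm_power_integral epowr_ennreal)
next
  case top
  then show ?thesis by (simp add: eLp_norm_power_integral epowr_def top_unique)
qed

lemma power_integral_le_sum:
  assumes "f \<in> borel_measurable lebesgue" "a \<le> s" "s \<le> b"
  shows "power_integral s f \<le> power_integral a f + power_integral b f"
proof -
  have "power_integral s f
      \<le> (\<integral>\<^sup>+ x. ennreal (norm (f x) powr a) + ennreal (norm (f x) powr b) \<partial>lebesgue)"
    unfolding power_integral_def
    using assms(2,3) powr_le_sum_of_powr
    by (intro nn_integral_mono) (auto simp: ennreal_plus[symmetric] simp del: ennreal_plus)
  also have "\<dots> = power_integral a f + power_integral b f"
    unfolding power_integral_def using assms(1) by (intro nn_integral_add) auto
  finally show ?thesis .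
qed

lemma power_integral_eq_0D:
  assumes "f \<in> borel_measurable lebesgue" "power_integral q f = 0"
  shows "AE x in lebesgue. f x = 0"
proof -
  have "AE x in lebesgue. ennreal (norm (f x) powr q) = 0"
    using assms by (subst nn_integral_0_iff_AE[symmetric]) (auto simp: power_integral_def)
  then show ?thesis by simp
qed

lemma power_integral_AE_0:
  assumes "AE x in lebesgue. f x = 0"
  shows "power_integral q f = 0"
proof -
  have "power_integral q f = (\<integral>\<^sup>+ x. 0 \<partial>(lebesgue :: (real^'a) measure))"
    unfolding power_integral_def using assms by (intro nn_integral_cong_AE) auto
  then show ?thesis by simp
qed

section \<open>Reciprocals and quotients in \<open>[0, \<infinity>]\<close>\<close>

lemma ennreal_one_divide: "a > 0 \<Longrightarrow> 1 / ennreal a = ennreal (1 / a)"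
  using divide_ennreal[of 1 a] by simp

text \<open>Includes \<open>1 / 0 = top\<close> and \<open>1 / top = 0\<close>, which occur when no
  \<open>\<alpha>\<close>, or every \<open>\<alpha>\<close>, is admissible in (T).\<close>

lemma ennreal_one_divide_antimono:
  fixes x y :: ennreal
  assumes "x \<le> y"
  shows "1 / y \<le> 1 / x"
proof (cases "x = 0 \<or> y = top")
  case True
  then show ?thesis by auto
next
  case False
  then obtain a b where "x = ennreal a" "y = ennreal b" "0 < a" "0 < b"
    using assms by (cases x; cases y) (auto simp: less_le top_unique)
  then show ?thesis
    using assms by (simp add: ennreal_one_divide frac_le)
qed

lemma ennreal_divide_le_iff:
  fixes x y :: ennreal
  assumes "d > 0"
  shows "x / ennreal d \<le> y \<longleftrightarrow> x \<le> y * ennreal d"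
proof
  assume "x / ennreal d \<le> y"
  then have "x / ennreal d * ennreal d \<le> y * ennreal d" by (rule mult_right_mono) simp
  also have "x / ennreal d * ennreal d = x"
    using assms by (simp add: ennreal_divide_times ennreal_times_divide mult_divide_eq_ennreal)
  finally show "x \<le> y * ennreal d" .
next
  assume "x \<le> y * ennreal d"
  then show "x / ennreal d \<le> y"
    using assms by (intro divide_le_posI_ennreal) (simp_all add: mult.commute)
qed

section \<open>(GN) and (T) along a positively homogeneous graph\<close>

locale homogeneous_Lp_graph =
  fixes p p' :: real and P :: "'n::finite graph"
  assumes p_gt_1: "1 < p" and conjugate: "1 / p + 1 / p' = 1"
    and homogeneous: "pos_homogeneous P"
    and in_Lp: "(f, g) \<in> P \<Longrightarrow> f \<in> Lp p \<and> g \<in> Lp p"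
begin

text \<open>Assertion (i) is the case \<open>r = p\<close>; the constant \<open>A\<close> admits
  every \<open>r \<ge> p\<close>.\<close>

definition GN_from :: "real \<Rightarrow> real \<Rightarrow> bool" where
  "GN_from C r \<longleftrightarrow> (\<forall>f g q. (f, g) \<in> P \<and> r \<le> q \<longrightarrow> GN p C q f g)"

definition Trudinger_with :: "real \<Rightarrow> real \<Rightarrow> bool" where
  "Trudinger_with \<alpha> D \<longleftrightarrow>
     (\<forall>f g. (f, g) \<in> P \<and> Lp_norm p g \<le> 1 \<longrightarrow> Trudinger p p' \<alpha> D f)"

text \<open>The factor \<open>C * q powr (1 - 1 / p)\<close> of (GN) raised to the power
  \<open>q\<close>.\<close>

definition GN_const :: "real \<Rightarrow> real \<Rightarrow> real" where
  "GN_const C q = C powr q * q powr (q / p')"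

lemma p'_gt_1: "1 < p'"
proof -
  have *: "1 / p' = 1 - 1 / p" using conjugate by simp
  then have "1 / p' > 0" "1 / p' < 1" using p_gt_1 by auto
  then show ?thesis by (auto simp: divide_less_eq split: if_splits)
qed

text \<open>Matches the cut-off in (T) with the range of (GN): \<open>p' * k \<ge> p\<close> holds
  exactly when \<open>k \<ge> p - 1\<close>.\<close>

lemma p'_times: "p' * (p - 1) = p"
  using conjugate p_gt_1 p'_gt_1 by (simp add: field_simps)

lemma inverse_conjugate: "1 - 1 / p = 1 / p'"
  using conjugate by simp

lemma Lp_norm_nonneg: "0 \<le> Lp_norm q f"
  by (simp add: Lp_norm_def)

text \<open>The \<open>q\<close>-th power of (GN): the exponents \<open>1 - p / q\<close> and
  \<open>p / q\<close> become \<open>q - p\<close> and \<open>p\<close>.\<close>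

lemma GN_iff:
  assumes "q > 0" "C \<ge> 0"
  shows "GN p C q f g \<longleftrightarrow>
    power_integral q f \<le> ennreal (GN_const C q * Lp_norm p g powr (q - p) * Lp_norm p f powr p)"
proof -
  have "(C * q powr (1 - 1 / p) * Lp_norm p g powr (1 - p / q) * Lp_norm p f powr (p / q)) powr q
      = GN_const C q * Lp_norm p g powr (q - p) * Lp_norm p f powr p"
    using assms Lp_norm_nonneg
    by (simp add: powr_mult powr_powr GN_const_def inverse_conjugate left_diff_distrib)
  then show ?thesis
    unfolding GN_def using assms Lp_norm_nonneg by (subst eLp_norm_le_iff) auto
qed

lemma GN_const_pos: "C > 0 \<Longrightarrow> q > 0 \<Longrightarrow> GN_const C q > 0"
  by (simp add: GN_const_def)

text \<open>Apply the normalised estimate to \<open>c * f\<close>: the left side gains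
  \<open>c powr q\<close>, the right side only \<open>c powr p\<close>. Taking
  \<open>c = 1 / Lp_norm p g\<close> produces the factor
  \<open>Lp_norm p g powr (q - p)\<close>.\<close>

lemma power_integral_scaling:
  assumes unit: "\<And>f g. (f, g) \<in> P \<Longrightarrow> Lp_norm p g \<le> 1 \<Longrightarrow>
      power_integral q f \<le> ennreal (D * Lp_norm p f powr p)"
    and "q > p" "D \<ge> 0" "(f, g) \<in> P"
  shows "power_integral q f \<le> ennreal (D * Lp_norm p g powr (q - p) * Lp_norm p f powr p)"
proof -
  define N where "N = Lp_norm p f"
  have N: "N \<ge> 0" by (simp add: N_def Lp_norm_nonneg)
  have *: "power_integral q f \<le> ennreal (D * c powr (p - q) * N powr p)"
    if c: "c > 0" and le: "c * Lp_norm p g \<le> 1" for c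
  proof -
    have "power_integral q (\<lambda>x. c *\<^sub>R f x) \<le> ennreal (D * Lp_norm p (\<lambda>x. c *\<^sub>R f x) powr p)"
      using c le p_gt_1
      by (intro unit[OF pos_homogeneousD[OF homogeneous c assms(4)]]) (simp add: Lp_norm_scaleR)
    then have "ennreal (c powr q) * power_integral q f \<le> ennreal (D * (c * N) powr p)"
      using c p_gt_1 by (simp add: power_integral_scaleR Lp_norm_scaleR N_def)
    then have "ennreal (c powr - q) * (ennreal (c powr q) * power_integral q f)
        \<le> ennreal (c powr - q) * ennreal (D * (c * N) powr p)"
      by (intro mult_left_mono) auto
    also have "ennreal (c powr - q) * (ennreal (c powr q) * power_integral q f) = power_integral q f"
      using c by (simp add: mult.assoc[symmetric] ennreal_mult[symmetric] powr_add[symmetric])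
    also have "ennreal (c powr - q) * ennreal (D * (c * N) powr p)
        = ennreal (D * c powr (p - q) * N powr p)"
      using c N \<open>D \<ge> 0\<close>
      by (simp add: ennreal_mult[symmetric] powr_mult powr_diff powr_minus_divide mult.commute)
    finally show ?thesis .
  qed
  show ?thesis
  proof (cases "Lp_norm p g = 0")
    case False
    then have G: "Lp_norm p g > 0" using Lp_norm_nonneg[of p g] by simp
    then have "(1 / Lp_norm p g) powr (p - q) = Lp_norm p g powr (q - p)"
      by (simp add: powr_divide powr_minus_divide[symmetric])
    then show ?thesis using *[of "1 / Lp_norm p g"] G by (simp add: N_def)
  next
    case True
    \<comment> \<open>When \<open>g\<close> has norm 0 every \<open>c > 0\<close> is admissible, and
      since \<open>p - q < 0\<close> the bound vanishes as \<open>c\<close> grows.\<close>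
    have "((\<lambda>c. D * c powr (p - q) * N powr p) \<longlongrightarrow> D * 0 * N powr p) at_top"
      using \<open>q > p\<close> by (intro tendsto_intros tendsto_neg_powr filterlim_ident) auto
    then have "((\<lambda>c. ennreal (D * c powr (p - q) * N powr p)) \<longlongrightarrow> ennreal 0) at_top"
      by (intro tendsto_ennrealI) simp
    moreover have "\<forall>\<^sub>F c in at_top. power_integral q f \<le> ennreal (D * c powr (p - q) * N powr p)"
      using eventually_gt_at_top[of "0::real"] by eventually_elim (use * True in auto)
    ultimately have "power_integral q f \<le> ennreal 0"
      by (intro tendsto_lowerbound[of _ _ at_top]) auto
    then show ?thesis using True by simp
  qed
qed

lemma power_integral_le_GN_const:
  assumes "GN_from C r" "C > 0" "r \<ge> p" "(f, g) \<in> P" "Lp_norm p g \<le> 1" "r \<le> q"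
  shows "power_integral q f \<le> ennreal (GN_const C q * Lp_norm p f powr p)"
proof -
  have q: "q > 0" "q \<ge> p" using assms p_gt_1 by auto
  have "power_integral q f
      \<le> ennreal (GN_const C q * Lp_norm p g powr (q - p) * Lp_norm p f powr p)"
    using assms q GN_iff[of q C f g] by (auto simp: GN_from_def)
  also have "\<dots> \<le> ennreal (GN_const C q * 1 * Lp_norm p f powr p)"
    using q assms(5) Lp_norm_nonneg[of p g] GN_const_pos[OF assms(2) q(1)]
    by (intro ennreal_leI mult_mono mult_nonneg_nonneg powr_le1) auto
  finally show ?thesis by simp
qed

text \<open>(GN) is assumed only from \<open>r\<close> on. Interpolation between \<open>p\<close>
  and \<open>r\<close> fills the gap with a constant independent of \<open>q\<close>.\<close>

lemma power_integral_le_interpolated: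
  assumes "GN_from C r" "C > 0" "r \<ge> p" "(f, g) \<in> P" "Lp_norm p g \<le> 1" "p \<le> q" "q \<le> r"
  shows "power_integral q f \<le> ennreal ((1 + GN_const C r) * Lp_norm p f powr p)"
proof -
  have f: "f \<in> Lp p" using in_Lp assms(4) by blast
  have "power_integral q f \<le> power_integral p f + power_integral r f"
    using f assms by (intro power_integral_le_sum) (auto simp: Lp_def)
  also have "power_integral p f = ennreal (Lp_norm p f powr p)"
    using f p_gt_1 by (intro power_integral_eq_Lp_norm) auto
  also have "ennreal (Lp_norm p f powr p) + power_integral r f
      \<le> ennreal (Lp_norm p f powr p) + ennreal (GN_const C r * Lp_norm p f powr p)"
    using assms(4,5) by (intro add_left_mono power_integral_le_GN_const[OF assms(1-3)]) auto
  also have "\<dots> = ennreal ((1 + GN_const C r) * Lp_norm p f powr p)"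
    using GN_const_pos[OF assms(2), of r] assms(3) p_gt_1
    by (simp add: ennreal_plus[symmetric] algebra_simps del: ennreal_plus)
  finally show ?thesis .
qed

text \<open>The interpolation constant \<open>K\<close> exceeds 1 and \<open>q \<ge> 1\<close>, so
  \<open>K \<le> C1 powr q\<close> for \<open>C1 = max C K\<close>; the growth factor
  \<open>q powr (q / p')\<close> is at least 1.\<close>

lemma GN_from_extend:
  assumes "GN_from C r" "C > 0" "r \<ge> p"
  obtains C1 where "C1 > 0" "GN_from C1 p"
proof
  define K where "K = 1 + GN_const C r"
  have K: "K > 1" using GN_const_pos[OF assms(2), of r] assms(3) p_gt_1 by (simp add: K_def)
  define C1 where "C1 = max C K"
  show "C1 > 0" using K by (simp add: C1_def)
  show "GN_from C1 p"
    unfolding GN_from_def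
  proof (intro allI impI, elim conjE)
    fix f g q assume fg: "(f, g) \<in> P" and "p \<le> q"
    then have q: "q > 0" "q \<ge> 1" using p_gt_1 by auto
    have f: "f \<in> Lp p" using in_Lp fg by blast
    have "power_integral q f \<le> ennreal (GN_const C1 q * Lp_norm p g powr (q - p) * Lp_norm p f powr p)"
    proof (cases "q \<ge> r")
      case True
      have "power_integral q f
          \<le> ennreal (GN_const C q * Lp_norm p g powr (q - p) * Lp_norm p f powr p)"
        using True assms q fg GN_iff[of q C f g] by (auto simp: GN_from_def)
      also have "\<dots> \<le> ennreal (GN_const C1 q * Lp_norm p g powr (q - p) * Lp_norm p f powr p)"
        using assms q unfolding GN_const_def C1_def
        by (intro ennreal_leI mult_right_mono powr_mono2) auto
      finally show ?thesis .
    next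
      case False
      have "K powr 1 \<le> C1 powr q"
        using K q by (intro powr_mono_both) (auto simp: C1_def)
      moreover have "1 \<le> q powr (q / p')"
        using q p'_gt_1 by (intro ge_one_powr_ge_zero) auto
      ultimately have KC: "K * 1 \<le> GN_const C1 q"
        unfolding GN_const_def using K by (intro mult_mono) auto
      show ?thesis
      \<comment> \<open>The scaling argument works only for \<open>q > p\<close>, hence the separate
        treatment of the endpoint.\<close>
      proof (cases "q = p")
        case qp: True
        show ?thesis
        proof (cases "Lp_norm p g = 0")
          \<comment> \<open>Here \<open>0 powr (p - p) = 0\<close>, so (GN) at \<open>q = p\<close> forces \<open>f = 0\<close>.\<close>
          case True
          \<comment> \<open>(GN) at \<open>r + 1\<close>, an exponent above \<open>p\<close>, has
            right side 0 as well, so \<open>f\<close> does vanish almost everywhere.\<close>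
          have "power_integral (r + 1) f \<le> 0"
            using assms fg True GN_iff[of "r + 1" C f g] p_gt_1 by (auto simp: GN_from_def)
          then have "AE x in lebesgue. f x = 0"
            using f by (intro power_integral_eq_0D[where q = "r + 1"]) (auto simp: Lp_def)
          then show ?thesis by (simp add: power_integral_AE_0)
        next
          case False
          have "Lp_norm p f powr p * 1 \<le> Lp_norm p f powr p * GN_const C1 q"
            using KC K by (intro mult_left_mono) auto
          then show ?thesis
            using False f p_gt_1 by (simp add: qp power_integral_eq_Lp_norm mult.commute ennreal_leI)
        qed
      next
        case qp: False
        have "power_integral q f
            \<le> ennreal (K * Lp_norm p g powr (q - p) * Lp_norm p f powr p)"
          using power_integral_le_interpolated[OF assms] False qp \<open>p \<le> q\<close> K fg
          by (intro power_integral_scaling) (auto simp: K_def)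
        also have "\<dots> \<le> ennreal (GN_const C1 q * Lp_norm p g powr (q - p) * Lp_norm p f powr p)"
          using KC by (intro ennreal_leI mult_right_mono) auto
        finally show ?thesis .
      qed
    qed
    then show "GN p C1 q f g" using q \<open>C1 > 0\<close> GN_iff[of q C1 f g] by simp
  qed
qed

section \<open>Passing between (GN) and (T)\<close>

lemma p'_times_nat_ge:
  assumes "p - 1 \<le> real k"
  shows "p \<le> p' * real k"
  using mult_left_mono[OF assms, of p'] p'_gt_1 p'_times by simp

text \<open>All terms of the tail are non-negative, so sum and integral may be exchanged.\<close>

lemma nn_integral_exp_tail:
  assumes "f \<in> borel_measurable lebesgue" "\<alpha> > 0"
  shows "(\<integral>\<^sup>+ x. ennreal (exp_tail (p - 1) (\<alpha> * norm (f x) powr p')) \<partial>lebesgue)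
    = (\<Sum>i. ennreal (\<alpha> ^ (i + nat \<lceil>p - 1\<rceil>) / fact (i + nat \<lceil>p - 1\<rceil>))
        * power_integral (p' * real (i + nat \<lceil>p - 1\<rceil>)) f)"
proof -
  define m where "m = nat \<lceil>p - 1\<rceil>"
  \<comment> \<open>Keeps the exponents positive: at zeros of \<open>f\<close>,
    \<open>0 powr 0 = 0\<close> would disagree with \<open>0 ^ 0 = 1\<close>.\<close>
  have m: "m \<ge> 1" using p_gt_1 by (simp add: m_def Suc_le_eq)
  have pw: "(\<alpha> * norm z powr p') ^ (i + m) / fact (i + m)
      = \<alpha> ^ (i + m) / fact (i + m) * norm z powr (p' * real (i + m))" for z :: complex and i
    using m by (simp add: power_mult_distrib powr_realpow'[symmetric] powr_powr)
  have "ennreal (exp_tail (p - 1) (\<alpha> * norm z powr p'))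
      = (\<Sum>i. ennreal (\<alpha> ^ (i + m) / fact (i + m)) * ennreal (norm z powr (p' * real (i + m))))"
    for z :: complex
  proof -
    have "(\<lambda>i. \<alpha> ^ (i + m) / fact (i + m) * norm z powr (p' * real (i + m)))
        sums exp_tail (p - 1) (\<alpha> * norm z powr p')"
      using exp_tail_sums[of "\<alpha> * norm z powr p'" "p - 1"] unfolding m_def[symmetric] pw .
    then have "ennreal (exp_tail (p - 1) (\<alpha> * norm z powr p'))
        = (\<Sum>i. ennreal (\<alpha> ^ (i + m) / fact (i + m) * norm z powr (p' * real (i + m))))"
      using \<open>\<alpha> > 0\<close>
      by (intro sums_unique sums_ennreal[THEN iffD2]) (auto intro: exp_tail_nonneg)
    then show ?thesis using \<open>\<alpha> > 0\<close> by (simp add: ennreal_mult[symmetric])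
  qed
  then show ?thesis
    unfolding power_integral_def m_def[symmetric] using assms
    by (simp add: nn_integral_suminf nn_integral_cmult)
qed

lemma Trudinger_iff:
  "Trudinger p p' \<alpha> D f \<longleftrightarrow>
    (\<integral>\<^sup>+ x. ennreal (exp_tail (p - 1) (\<alpha> * norm (f x) powr p')) \<partial>lebesgue)
      \<le> ennreal (D * Lp_norm p f powr p)"
  by (simp add: Trudinger_def exp_tail_def)

text \<open>Exponents \<open>p' * k\<close> from \<open>r\<close> on are handled by (GN), the
  finitely many smaller ones by interpolation; the sum of the resulting bounds converges.\<close>

lemma Trudinger_of_GN:
  assumes GN: "GN_from C r" "C > 0" "r \<ge> p"
    and \<alpha>: "\<alpha> > 0" "\<alpha> * p' * exp 1 * C powr p' < 1"
  obtains D where "D > 0" "Trudinger_with \<alpha> D"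
proof
  define \<theta> where "\<theta> = \<alpha> * p' * exp 1 * C powr p'"
  have \<theta>: "0 < \<theta>" "\<theta> < 1" using \<alpha> p'_gt_1 GN(2) by (auto simp: \<theta>_def)
  define K where "K = 1 + GN_const C r"
  have K: "K > 1" using GN_const_pos[OF GN(2), of r] GN(3) p_gt_1 by (simp add: K_def)
  define m where "m = nat \<lceil>p - 1\<rceil>"
  have m: "m \<ge> 1" "p - 1 \<le> real m" using p_gt_1 by (simp_all add: m_def Suc_le_eq)
  \<comment> \<open>One bound for both ranges: the first summand serves \<open>p' * k < r\<close>,
    the second \<open>p' * k \<ge> r\<close>. They sum to an exponential and a geometric
    series.\<close>
  define b where "b k = K * (\<alpha> ^ k / fact k) + \<theta> ^ k" for k :: nat
  have b: "b k > 0" for k using K \<theta> \<alpha> by (auto simp: b_def intro!: add_pos_pos mult_pos_pos)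
  have series_bound: "\<alpha> ^ k / fact k * GN_const C (p' * real k) \<le> \<theta> ^ k" if "k \<ge> 1" for k
  proof -
    \<comment> \<open>At \<open>q = p' * k\<close> the exponent \<open>q / p'\<close> is the integer
      \<open>k\<close>, which produces \<open>k^k\<close> to set against \<open>k!\<close>.\<close>
    have "GN_const C (p' * real k) = (C powr p') ^ k * p' ^ k * real k ^ k"
      using that p'_gt_1 GN(2)
      by (simp add: GN_const_def powr_powr[symmetric] powr_realpow power_mult_distrib)
    then have "\<alpha> ^ k / fact k * GN_const C (p' * real k)
        = (\<alpha> * p' * C powr p') ^ k * (real k ^ k / fact k)"
      by (simp add: power_mult_distrib)
    also have "\<dots> \<le> (\<alpha> * p' * C powr p') ^ k * exp 1 ^ k"
      using \<alpha> p'_gt_1 by (intro mult_left_mono power_le_exp_times_fact) auto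
    also have "\<dots> = \<theta> ^ k" by (simp add: \<theta>_def power_mult_distrib)
    finally show ?thesis .
  qed
  have summable_b: "summable (\<lambda>i. b (i + m))"
    unfolding b_def using \<theta> summable_exp[of \<alpha>]
    by (intro summable_ignore_initial_segment[where f = b, unfolded b_def] summable_add summable_mult
        summable_geometric) (auto simp: divide_inverse mult.commute)
  define D where "D = (\<Sum>i. b (i + m))"
  show "D > 0" unfolding D_def using summable_b b by (intro suminf_pos)
  show "Trudinger_with \<alpha> D"
    unfolding Trudinger_with_def Trudinger_iff
  proof (intro allI impI, elim conjE)
    fix f g assume fg: "(f, g) \<in> P" "Lp_norm p g \<le> 1"
    have f: "f \<in> borel_measurable lebesgue" using in_Lp fg(1) by (auto simp: Lp_def)
    have le: "ennreal (\<alpha> ^ k / fact k) * power_integral (p' * real k) f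
        \<le> ennreal (b k * Lp_norm p f powr p)" if "k \<ge> m" for k
    proof -
      have k: "k \<ge> 1" "p \<le> p' * real k" using that m by (auto intro: p'_times_nat_ge)
      obtain B where B: "B \<ge> 0" "power_integral (p' * real k) f \<le> ennreal (B * Lp_norm p f powr p)"
        "\<alpha> ^ k / fact k * B \<le> b k"
      proof (cases "p' * real k \<ge> r")
        case True
        have "0 \<le> K * (\<alpha> ^ k / fact k)" using K \<alpha> by simp
        then show ?thesis
          using True k fg GN series_bound[OF k(1)] p'_gt_1 GN_const_pos[OF GN(2), of "p' * real k"]
          by (intro that[of "GN_const C (p' * real k)"] power_integral_le_GN_const[OF GN])
            (auto simp: b_def)
      next
        case False
        have "power_integral (p' * real k) f \<le> ennreal (K * Lp_norm p f powr p)"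
          unfolding K_def using False by (intro power_integral_le_interpolated[OF GN fg k(2)]) simp
        moreover have "\<alpha> ^ k / fact k * K \<le> b k" using \<theta> by (simp add: b_def mult.commute)
        ultimately show ?thesis using K by (intro that[of K]) auto
      qed
      have "ennreal (\<alpha> ^ k / fact k) * power_integral (p' * real k) f
          \<le> ennreal (\<alpha> ^ k / fact k) * ennreal (B * Lp_norm p f powr p)"
        using B(2) by (intro mult_left_mono) auto
      also have "\<dots> = ennreal ((\<alpha> ^ k / fact k * B) * Lp_norm p f powr p)"
        using B(1) \<alpha> by (simp add: ennreal_mult[symmetric] mult.assoc)
      also have "\<dots> \<le> ennreal (b k * Lp_norm p f powr p)"
        using B(3) by (intro ennreal_leI mult_right_mono) auto
      finally show ?thesis .
    qed
    have "(\<integral>\<^sup>+ x. ennreal (exp_tail (p - 1) (\<alpha> * norm (f x) powr p')) \<partial>lebesgue)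
        \<le> (\<Sum>i. ennreal (b (i + m) * Lp_norm p f powr p))"
      unfolding nn_integral_exp_tail[OF f \<alpha>(1)] m_def[symmetric]
      by (intro suminf_le le) auto
    also have "\<dots> = ennreal (D * Lp_norm p f powr p)"
      unfolding D_def using summable_b b
      by (subst suminf_ennreal2) (auto simp: less_imp_le suminf_mult2[symmetric] intro!: summable_mult2)
    finally show "(\<integral>\<^sup>+ x. ennreal (exp_tail (p - 1) (\<alpha> * norm (f x) powr p')) \<partial>lebesgue)
        \<le> ennreal (D * Lp_norm p f powr p)" .
  qed
qed

text \<open>Integrating the pointwise bound of \<open>|f|^q\<close> by the tail gives the estimate
  for \<open>Lp_norm p g \<le> 1\<close>; homogeneity then removes the normalisation.\<close>

lemma GN_of_Trudinger:
  assumes T: "Trudinger_with \<alpha> D" "D > 0" "\<alpha> > 0"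
    and C: "C > 0" "\<alpha> * p' * exp 1 * C powr p' > 1"
  obtains r where "r \<ge> p" "GN_from C r"
proof -
  define \<beta> where "\<beta> = \<alpha> * p' * exp 1 * C powr p'"
  have \<beta>: "\<beta> > 1" using C by (simp add: \<beta>_def)
  \<comment> \<open>Since \<open>\<beta> > 1\<close>, \<open>\<beta> powr s\<close> absorbs
    \<open>D\<close> and the polynomial loss once \<open>s\<close> is large. This determines where
    (GN) starts.\<close>
  have "((\<lambda>s. D * (exp 1 * ((s + 2) * s)) / \<beta> powr s) \<longlongrightarrow> 0) at_top"
    using \<beta> T(2) by real_asymp
  then have "\<forall>\<^sub>F s in at_top. D * (exp 1 * ((s + 2) * s)) / \<beta> powr s < 1"
    by (rule order_tendstoD) simp
  then obtain s0 where s0: "\<And>s. s \<ge> s0 \<Longrightarrow> D * (exp 1 * ((s + 2) * s)) / \<beta> powr s < 1"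
    by (auto simp: eventually_at_top_linorder)
  define s1 where "s1 = max s0 p"
  \<comment> \<open>\<open>p + 1\<close> ensures \<open>q > p\<close> for the scaling;
    \<open>p' * s1\<close> ensures \<open>s \<ge> s0\<close> and \<open>s \<ge> p\<close>, the
    latter being the condition of \<open>powr_le_exp_tail\<close> for
    \<open>a = p - 1\<close>.\<close>
  define r where "r = max (p + 1) (p' * s1)"
  have "GN p C q f g" if fg: "(f, g) \<in> P" and q: "r \<le> q" for f g q
  proof -
    define s where "s = q / p'"
    have "p' * s1 \<le> q" using q by (simp add: r_def)
    then have "s1 \<le> s" using p'_gt_1 by (simp add: s_def field_simps)
    then have s: "s \<ge> s0" "s \<ge> p" "q = p' * s"
      using p'_gt_1 by (simp_all add: s_def s1_def)
    have q0: "q > p" using q by (simp add: r_def)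
    define M where "M = (s + 2) * (exp 1 * s * (s / exp 1) powr s)"
    have M: "M > 0" using s p_gt_1 by (simp add: M_def)
    have "D * (exp 1 * ((s + 2) * s)) \<le> \<beta> powr s"
      using s0[OF s(1)] \<beta> by (simp add: field_simps)
    then have "\<alpha> powr - s * (D * (exp 1 * ((s + 2) * s))) * (s / exp 1) powr s
        \<le> \<alpha> powr - s * \<beta> powr s * (s / exp 1) powr s"
      by (intro mult_left_mono mult_right_mono) auto
    \<comment> \<open>The powers of \<open>\<alpha>\<close> and \<open>e\<close> cancel, leaving
      \<open>C powr q * (p' * s) powr s\<close> with \<open>p' * s = q\<close>.\<close>
    also have "\<dots> = GN_const C q"
    proof -
      have "\<beta> = \<alpha> * (exp 1 * (p' * C powr p'))" by (simp add: \<beta>_def)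
      then have "\<beta> powr s = \<alpha> powr s * (exp 1 powr s * (p' powr s * C powr q))"
        using T(3) p'_gt_1 C(1) by (simp add: powr_mult powr_powr s(3))
      then show ?thesis
        using T(3) p'_gt_1 s p_gt_1
        by (simp add: GN_const_def powr_mult powr_divide powr_minus field_simps)
    qed
    finally have MD: "\<alpha> powr - s * (M * D) \<le> GN_const C q"
      by (simp add: M_def algebra_simps)
    have unit: "power_integral q f \<le> ennreal (GN_const C q * Lp_norm p f powr p)"
      if fg: "(f, g) \<in> P" "Lp_norm p g \<le> 1" for f g
    proof -
      have f: "f \<in> borel_measurable lebesgue" using in_Lp fg(1) by (auto simp: Lp_def)
      have "norm z powr q \<le> \<alpha> powr - s * M * exp_tail (p - 1) (\<alpha> * norm z powr p')" for z :: complex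
      proof -
        have "norm z powr q = \<alpha> powr - s * (\<alpha> * norm z powr p') powr s"
          using T(3) by (simp add: powr_mult powr_powr s(3) powr_minus)
        also have "\<dots> \<le> \<alpha> powr - s * (M * exp_tail (p - 1) (\<alpha> * norm z powr p'))"
          unfolding M_def using T(3) s p_gt_1 by (intro mult_left_mono powr_le_exp_tail) auto
        finally show ?thesis by (simp add: mult.assoc)
      qed
      then have "power_integral q f
          \<le> (\<integral>\<^sup>+ x. ennreal (\<alpha> powr - s * M) *
                ennreal (exp_tail (p - 1) (\<alpha> * norm (f x) powr p')) \<partial>lebesgue)"
        unfolding power_integral_def using M
        by (intro nn_integral_mono) (auto simp: ennreal_mult'[symmetric] intro!: ennreal_leI)
      also have "\<dots> = ennreal (\<alpha> powr - s * M) *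
          (\<integral>\<^sup>+ x. ennreal (exp_tail (p - 1) (\<alpha> * norm (f x) powr p')) \<partial>lebesgue)"
        using M T(3) by (intro nn_integral_cmult_pos) auto
      also have "\<dots> \<le> ennreal (\<alpha> powr - s * M) * ennreal (D * Lp_norm p f powr p)"
        using T(1) fg by (intro mult_left_mono) (auto simp: Trudinger_with_def Trudinger_iff)
      also have "\<dots> = ennreal (\<alpha> powr - s * (M * D) * Lp_norm p f powr p)"
        using M T(2) by (simp add: ennreal_mult[symmetric] mult.assoc)
      also have "\<dots> \<le> ennreal (GN_const C q * Lp_norm p f powr p)"
        using MD by (intro ennreal_leI mult_right_mono) auto
      finally show ?thesis .
    qed
    show ?thesis
      using power_integral_scaling[OF unit q0 _ fg] GN_iff[of q C f g] C(1) q0 p_gt_1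
      by (simp add: GN_const_pos less_imp_le)
  qed
  then show thesis by (intro that[of r]) (auto simp: r_def GN_from_def)
qed

lemma GN_from_iff_Trudinger_with:
  "(\<exists>C>0. GN_from C p) \<longleftrightarrow> (\<exists>\<alpha>>0. \<exists>D>0. Trudinger_with \<alpha> D)"
proof
  assume "\<exists>C>0. GN_from C p"
  then obtain C where C: "C > 0" "GN_from C p" by blast
  \<comment> \<open>Half the threshold value.\<close>
  define \<alpha> where "\<alpha> = 1 / (2 * p' * exp 1 * C powr p')"
  have \<alpha>: "\<alpha> > 0" "\<alpha> * p' * exp 1 * C powr p' = 1 / 2"
    using C(1) p'_gt_1 by (simp_all add: \<alpha>_def field_simps)
  show "\<exists>\<alpha>>0. \<exists>D>0. Trudinger_with \<alpha> D"
    using Trudinger_of_GN[OF C(2,1) order_refl \<alpha>(1)] \<alpha> by force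
next
  assume "\<exists>\<alpha>>0. \<exists>D>0. Trudinger_with \<alpha> D"
  then obtain \<alpha> D where T: "\<alpha> > 0" "D > 0" "Trudinger_with \<alpha> D" by blast
  \<comment> \<open>Solves \<open>\<alpha> * p' * exp 1 * C powr p' = 2\<close>, safely above the
    threshold 1.\<close>
  define C where "C = (2 / (\<alpha> * p' * exp 1)) powr (1 / p')"
  have C: "C > 0" "\<alpha> * p' * exp 1 * C powr p' = 2"
    using T(1) p'_gt_1 by (simp_all add: C_def powr_powr)
  obtain r where "r \<ge> p" "GN_from C r"
    using GN_of_Trudinger[OF T(3,2,1) C(1)] C(2) by auto
  then show "\<exists>C>0. GN_from C p" using GN_from_extend C(1) by blast
qed

section \<open>The three constants\<close>

lemma GN_from_iff_Domain:
  "GN_from C r \<longleftrightarrow> (\<forall>f\<in>Domain P. \<forall>g. (f, g) \<in> P \<longrightarrow> (\<forall>q\<ge>r. GN p C q f g))"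
  unfolding GN_from_def by blast

lemma Trudinger_with_iff_Domain:
  "Trudinger_with \<alpha> D \<longleftrightarrow>
    (\<forall>f\<in>Domain P. \<forall>g. (f, g) \<in> P \<and> Lp_norm p g \<le> 1 \<longrightarrow> Trudinger p p' \<alpha> D f)"
  unfolding Trudinger_with_def by blast

lemma GN_inf_eq: "GN_inf p (Domain P) P = Inf {ennreal C |C. C > 0 \<and> (\<exists>r\<ge>p. GN_from C r)}"
  unfolding GN_inf_def GN_from_iff_Domain ..

lemma alpha_tilde_eq:
  "alpha_tilde p p' (Domain P) P = Sup {ennreal \<alpha> |\<alpha>. \<alpha> > 0 \<and> (\<exists>D>0. Trudinger_with \<alpha> D)}"
  unfolding alpha_tilde_def Trudinger_with_iff_Domain ..

text \<open>If the denominator vanishes both sides are false: the numerator is nonzero, so the ratio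
  is infinite, while (GN) would make the numerator 0.\<close>

lemma GN_ratio_le_iff:
  assumes "f \<in> Lp p" "q > p" "C > 0" "\<not> (AE x in lebesgue. f x = 0)"
  shows "GN_ratio p q f g \<le> ennreal C \<longleftrightarrow> GN p C q f g"
proof -
  define d where "d = q powr (1 - 1 / p) * Lp_norm p g powr (1 - p / q) * Lp_norm p f powr (p / q)"
  have d: "d \<ge> 0" by (simp add: d_def)
  have "eLp_norm q f \<noteq> 0"
  proof
    assume "eLp_norm q f = 0"
    then have "power_integral q f \<le> ennreal (0 powr q)"
      using assms(2) p_gt_1 eLp_norm_le_iff[of q 0 f] by simp
    then show False using assms power_integral_eq_0D[of f q] by (auto simp: Lp_def)
  qed
  moreover have "ennreal (C * q powr (1 - 1 / p) * Lp_norm p g powr (1 - p / q) * Lp_norm p f powr (p / q))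
      = ennreal C * ennreal d"
    using assms(3) by (simp add: d_def ennreal_mult[symmetric] mult.assoc)
  ultimately show ?thesis
    unfolding GN_ratio_def GN_def d_def[symmetric] using d
    by (cases "d = 0") (simp_all add: top_unique ennreal_divide_le_iff)
qed

text \<open>Functions vanishing almost everywhere satisfy (GN) trivially, so leaving them out of the
  supremum changes nothing.\<close>

lemma GN_ratio_Sup_le_iff:
  assumes "q > p" "C > 0"
  shows "Sup {GN_ratio p q f g |f g. f \<in> Domain P \<and> (f, g) \<in> P \<and> \<not> (AE x in lebesgue. f x = 0)}
      \<le> ennreal C \<longleftrightarrow> (\<forall>f g. (f, g) \<in> P \<longrightarrow> GN p C q f g)"
proof -
  have "GN p C q f g" if "AE x in lebesgue. f x = 0" for f g :: "'n cfun"
    using power_integral_AE_0[OF that, of q] assms p_gt_1 GN_iff[of q C f g] by simp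
  moreover have "GN_ratio p q f g \<le> ennreal C \<longleftrightarrow> GN p C q f g"
    if "(f, g) \<in> P" "\<not> (AE x in lebesgue. f x = 0)" for f g
    using GN_ratio_le_iff[OF _ assms that(2)] in_Lp[OF that(1)] by blast
  ultimately have "(\<forall>f g. (f, g) \<in> P \<longrightarrow> GN p C q f g) \<longleftrightarrow>
      (\<forall>f g. (f, g) \<in> P \<and> \<not> (AE x in lebesgue. f x = 0) \<longrightarrow> GN_ratio p q f g \<le> ennreal C)"
    by metis
  then show ?thesis unfolding Sup_le_iff by auto
qed

text \<open>A constant above the limsup bounds the suprema for all large \<open>q\<close>, so it is
  admissible in the infimum; an admissible constant bounds them eventually, hence bounds the
  limsup.\<close>

lemma GN_inf_eq_GN_limsup: "GN_inf p (Domain P) P = GN_limsup p (Domain P) P"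
proof (rule antisym)
  define S where "S q = Sup {GN_ratio p q f g |f g. f \<in> Domain P \<and> (f, g) \<in> P \<and>
      \<not> (AE x in lebesgue. f x = 0)}" for q
  have L: "GN_limsup p (Domain P) P = Limsup at_top S" by (simp add: GN_limsup_def S_def[abs_def])
  have S: "S q \<le> ennreal C \<longleftrightarrow> (\<forall>f g. (f, g) \<in> P \<longrightarrow> GN p C q f g)" if "q > p" "C > 0" for q C
    unfolding S_def by (rule GN_ratio_Sup_le_iff[OF that])
  show "GN_inf p (Domain P) P \<le> GN_limsup p (Domain P) P"
  proof (rule dense_ge)
    fix y assume "GN_limsup p (Domain P) P < y"
    \<comment> \<open>Lying strictly between two elements, \<open>z\<close> is positive and finite
      and can serve as a constant in (GN).\<close>
    then obtain z where z: "Limsup at_top S < z" "z < y" unfolding L by (meson dense)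
    then have "z < top" "0 < z" by (auto intro: order.strict_trans2 order.strict_trans1)
    then obtain C where C: "C > 0" "z = ennreal C" by (cases z) (auto simp: ennreal_less_zero_iff)
    have "\<forall>\<^sub>F q in at_top. S q < ennreal C" using z(1) C(2) Limsup_lessD by blast
    then obtain r where r: "\<And>q. q \<ge> r \<Longrightarrow> S q < ennreal C"
      by (auto simp: eventually_at_top_linorder)
    have "GN_from C (max r (p + 1))"
      unfolding GN_from_def
    proof (intro allI impI, elim conjE)
      fix f g q assume "(f, g) \<in> P" "max r (p + 1) \<le> q"
      then show "GN p C q f g" using S[of q C] C(1) r[of q] by auto
    qed
    then have "GN_inf p (Domain P) P \<le> ennreal C"
      unfolding GN_inf_eq using C(1)
      by (intro Inf_lower CollectI exI[of _ C] conjI exI[of _ "max r (p + 1)"]) auto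
    then show "GN_inf p (Domain P) P \<le> y" using z(2) C(2) by simp
  qed
  show "GN_limsup p (Domain P) P \<le> GN_inf p (Domain P) P"
    unfolding GN_inf_eq L
  proof (rule Inf_greatest, clarify)
    fix C r assume C: "C > 0" "GN_from C r"
    have "\<forall>\<^sub>F q in at_top. S q \<le> ennreal C"
      using eventually_ge_at_top[of r] eventually_gt_at_top[of p]
      by eventually_elim (use S C in \<open>auto simp: GN_from_def\<close>)
    then show "Limsup at_top S \<le> ennreal C" by (rule Limsup_bounded)
  qed
qed

text \<open>The threshold \<open>\<alpha> * p' * exp 1 * C powr p' = 1\<close> is the same in both
  directions. Each inequality is tested against a strictly larger \<open>z\<close>, the room needed
  for the strict conditions; infinite \<open>z\<close> is trivial.\<close>

lemma inverse_alpha_tilde: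
  "1 / (alpha_tilde p p' (Domain P) P * ennreal p' * ennreal (exp 1))
    = epowr (GN_inf p (Domain P) P) p'"
proof -
  define A where "A = GN_inf p (Domain P) P"
  define a where "a = alpha_tilde p p' (Domain P) P"
  define c where "c = p' * exp 1"
  have c: "c > 0" using p'_gt_1 by (simp add: c_def)
  have "a * ennreal p' * ennreal (exp 1) = a * ennreal c"
    using p'_gt_1 by (simp add: c_def mult.assoc ennreal_mult[symmetric])
  moreover have "1 / (a * ennreal c) = epowr A p'"
  proof (rule antisym)
    show "1 / (a * ennreal c) \<le> epowr A p'"
    proof (rule dense_ge)
      fix z assume z: "epowr A p' < z"
      show "1 / (a * ennreal c) \<le> z"
      proof (cases z)
        case (real y)
        then have y: "y > 0" using z by (auto simp: ennreal_less_zero_iff intro: ccontr)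
        \<comment> \<open>Being strictly above the infimum, \<open>y powr (1 / p')\<close> leaves
          room for an admissible \<open>C\<close> below it.\<close>
        have "A < ennreal (y powr (1 / p'))"
        proof (cases A)
          case (real b)
          then have "b powr p' < y" using z \<open>z = ennreal y\<close> by (simp add: epowr_ennreal ennreal_less_iff)
          then have "(b powr p') powr (1 / p') < y powr (1 / p')"
            using p'_gt_1 by (intro powr_less_mono2) auto
          then show ?thesis using real p'_gt_1 by (simp add: powr_powr ennreal_less_iff)
        next
          case top
          then show ?thesis using z by (simp add: epowr_def)
        qed
        then obtain C r where C: "C > 0" "r \<ge> p" "GN_from C r" "C < y powr (1 / p')"
          unfolding A_def GN_inf_eq by (auto simp: Inf_less_iff ennreal_less_iff)
        have "C powr p' < (y powr (1 / p')) powr p'"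
          using C p'_gt_1 by (intro powr_less_mono2) auto
        then have Cy: "C powr p' < y" using p'_gt_1 y by (simp add: powr_powr)
        \<comment> \<open>The value with \<open>1 / (\<alpha> * c) = y\<close>; it lies below the
          threshold because \<open>C powr p' < y\<close>.\<close>
        define \<alpha> where "\<alpha> = 1 / (c * y)"
        have \<alpha>: "\<alpha> > 0" "\<alpha> * p' * exp 1 * C powr p' < 1"
          using Cy c y p'_gt_1 by (simp_all add: \<alpha>_def c_def field_simps)
        obtain D where "D > 0" "Trudinger_with \<alpha> D"
          using Trudinger_of_GN[OF C(3,1,2) \<alpha>] .
        then have "ennreal \<alpha> \<le> a"
          unfolding a_def alpha_tilde_eq using \<alpha>(1) by (intro Sup_upper) auto
        then have "1 / (a * ennreal c) \<le> 1 / (ennreal \<alpha> * ennreal c)"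
          by (intro ennreal_one_divide_antimono mult_right_mono) auto
        also have "\<dots> = ennreal y"
          using c y by (simp add: \<alpha>_def ennreal_mult[symmetric] ennreal_one_divide)
        finally show ?thesis using real by simp
      qed simp
    qed
    show "epowr A p' \<le> 1 / (a * ennreal c)"
    proof (rule dense_ge)
      fix z assume z: "1 / (a * ennreal c) < z"
      show "epowr A p' \<le> z"
      proof (cases z)
        case (real y)
        then have y: "y > 0" using z by (auto simp: ennreal_less_zero_iff intro: ccontr)
        \<comment> \<open>Argued by contradiction through the antitone reciprocal, which also covers
          \<open>a = 0\<close> and \<open>a = top\<close>.\<close>
        have "ennreal (1 / (c * y)) < a"
        proof (rule ccontr)
          assume "\<not> ennreal (1 / (c * y)) < a"
          then have "1 / (ennreal (1 / (c * y)) * ennreal c) \<le> 1 / (a * ennreal c)"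
            by (intro ennreal_one_divide_antimono mult_right_mono) auto
          moreover have "1 / (ennreal (1 / (c * y)) * ennreal c) = ennreal y"
            using c y by (simp add: ennreal_mult[symmetric] ennreal_one_divide)
          ultimately show False using z real by simp
        qed
        then obtain \<alpha> D where \<alpha>: "\<alpha> > 0" "D > 0" "Trudinger_with \<alpha> D" "1 / (c * y) < \<alpha>"
          unfolding a_def alpha_tilde_eq using c y by (auto simp: less_Sup_iff ennreal_less_iff)
        \<comment> \<open>Makes \<open>C powr p' = y\<close>, which exceeds
          \<open>1 / (\<alpha> * c)\<close> by the choice of \<open>\<alpha>\<close>.\<close>
        define C where "C = y powr (1 / p')"
        have C: "C > 0" "C powr p' = y" using y p'_gt_1 by (simp_all add: C_def powr_powr)
        have "\<alpha> * p' * exp 1 * C powr p' > 1"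
          using \<alpha>(4) c y p'_gt_1 by (simp add: C(2) c_def field_simps)
        then obtain r where "r \<ge> p" "GN_from C r"
          using GN_of_Trudinger[OF \<alpha>(3,2,1) C(1)] by blast
        then have "A \<le> ennreal C" unfolding A_def GN_inf_eq using C(1) by (intro Inf_lower) auto
        then obtain b where b: "b \<ge> 0" "b \<le> C" "A = ennreal b"
          using C(1) by (cases A) (auto simp: top_unique)
        then have "b powr p' \<le> y" using powr_mono2[of p' b C] p'_gt_1 C(2) by simp
        then show ?thesis using b real by (simp add: epowr_ennreal ennreal_leI)
      qed simp
    qed
  qed
  ultimately show ?thesis by (simp add: A_def a_def)
qed

end

text \<open>Identifies the function space of the theorem with \<open>Domain P\<close>, in terms of
  which the constants were compared.\<close>

lemma sobolev_eq_Domain: "sobolev p R \<nu> a = Domain (rockland_power p R (a / \<nu>))"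
  unfolding sobolev_def using rockland_power_Lp by blast

theorem theorem3p8:
  fixes mul :: "real^'n::finite \<Rightarrow> real^'n \<Rightarrow> real^'n"
    and w :: "'n \<Rightarrow> nat" and R :: "'n diffop" and \<nu> p p' Q :: real
    and W :: "'n cfun set" and P :: "'n graph"
  assumes "graded_lie_group mul w"
    and "positive_rockland mul w \<nu> R"
    and "1 < p" and "1 / p + 1 / p' = 1"
  defines "Q \<equiv> real (hom_dim w)"
    and "W \<equiv> sobolev p R \<nu> (Q / p)"
    and "P \<equiv> rockland_power p R (Q / (\<nu> * p))"
  shows "((\<exists>C1>0. \<forall>f\<in>W. \<forall>g. (f, g) \<in> P \<longrightarrow> (\<forall>q\<ge>p. GN p C1 q f g))
           \<longleftrightarrow>
         (\<exists>\<alpha>>0. \<exists>C2>0. \<forall>f\<in>W. \<forall>g. (f, g) \<in> P \<and> Lp_norm p g \<le> 1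
            \<longrightarrow> Trudinger p p' \<alpha> C2 f))
       \<and> 1 / (alpha_tilde p p' W P * ennreal p' * ennreal (exp 1)) = epowr (GN_inf p W P) p'
       \<and> epowr (GN_inf p W P) p' = epowr (GN_limsup p W P) p'"
proof -
  interpret homogeneous_Lp_graph p p' P
    using assms(3,4)
    by unfold_locales (auto simp: P_def intro: pos_homogeneous_rockland_power dest: rockland_power_Lp)
  \<comment> \<open>The orders \<open>Q / p / \<nu>\<close> and \<open>Q / (\<nu> * p)\<close>
    agree.\<close>
  have W: "W = Domain P" by (simp add: W_def P_def sobolev_eq_Domain mult.commute)
  show ?thesis
    using GN_from_iff_Trudinger_with inverse_alpha_tilde GN_inf_eq_GN_limsup
    unfolding W GN_from_iff_Domain Trudinger_with_iff_Domain by simp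
qed

end
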